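(* For every $\epsilon > 0$ there exists $p_0(\epsilon)$ such that for every prime $p \equiv 1 \pmod{3}$ with $p > p_0(\epsilon)$, \[ \#\{\text{primes } q < p^{\frac{1}{2}+\epsilon} : q \text{ is a cubic residue modulo } p\} > p^{\frac{1}{30}\epsilon}. \]
   Context: An integer $a$ is a cubic residue modulo the prime $p$ if $a \equiv y^3 \pmod{p}$ for some integer $y$ with $p \nmid y$. *)

theory Defs
  imports Complex_Main "HOL-Number_Theory.Number_Theory"
begin

definition cubic_residue :: "int \<Rightarrow> int \<Rightarrow> bool" where
  "cubic_residue p a \<longleftrightarrow> (\<exists>y::int. \<not> p dvd y \<and> [a = y ^ 3] (mod p))"

end

theory Submission
  imports Defs "HOL-Computational_Algebra.Polynomial" "HOL-Real_Asymp.Real_Asymp"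
begin

text \<open>
  Let $\chi$ be a cubic character modulo $p$ and let $J = a + b\omega$ be its Jacobi sum, so
  that $J\bar J = p$. For an integer $n$ write $F(n)$ for the $\omega$-coefficient of
  $J(n + \omega)^3$, a cubic polynomial in $n$ with coefficients of size $O(\sqrt p)$. If a
  prime $q \ne 3, p$ divides $F(n)$, then $J(n+\omega)^3$ is congruent to its conjugate modulo
  $q$, hence $pJ = J^2 \bar J$ is a cube modulo $q$, and the Gauss sum identity
  $g^{q^2 - 1} = (pJ)^{(q^2-1)/3}$ together with the Frobenius map yields $\chi(q) = 1$:
  every such $q$ is a cubic residue modulo $p$.

  It remains to see that the values $F(n)$ with $n$ in a suitable progression have many prime
  factors. There are at most three zeros modulo each prime power, so if only $K$ primes
  divide the values on a block of $H$ consecutive arguments, then, as in Chebyshev's argument,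
  the product of these values is at most $H!^3 X^{3K}$, where $X$ bounds the values. As $F$
  takes every value at most three times, some block contains only values that are larger than
  a power of $p$ exceeding $H^3$. With $H = p^{\epsilon/20}$ this is a contradiction unless
  $K > p^{\epsilon/30} + 2$.
\<close>

section \<open>Eisenstein integers\<close>

text \<open>\<open>Eis a b\<close> stands for $a + b\omega$ with $\omega^2 + \omega + 1 = 0$.\<close>

datatype eis = Eis (ere: int) (eim: int)

lemma eis_eq_iff: "x = y \<longleftrightarrow> ere x = ere y \<and> eim x = eim y"
  by (cases x; cases y) auto

instantiation eis :: comm_ring_1
begin

definition "0 = Eis 0 0"
definition "1 = Eis 1 0"
definition "x + y = Eis (ere x + ere y) (eim x + eim y)"
definition "x - y = Eis (ere x - ere y) (eim x - eim y)"
definition "- x = Eis (- ere x) (- eim x)"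
definition "x * y = Eis (ere x * ere y - eim x * eim y)
                        (ere x * eim y + eim x * ere y - eim x * eim y)"

instance
  by standard (auto simp: eis_eq_iff zero_eis_def one_eis_def plus_eis_def minus_eis_def
      uminus_eis_def times_eis_def algebra_simps)

end

lemma eis_sel [simp]:
  "ere 0 = 0" "eim 0 = 0" "ere 1 = 1" "eim 1 = 0"
  "ere (x + y) = ere x + ere y" "eim (x + y) = eim x + eim y"
  "ere (x - y) = ere x - ere y" "eim (x - y) = eim x - eim y"
  "ere (- x) = - ere x" "eim (- x) = - eim x"
  "ere (x * y) = ere x * ere y - eim x * eim y"
  "eim (x * y) = ere x * eim y + eim x * ere y - eim x * eim y"
  by (auto simp: zero_eis_def one_eis_def plus_eis_def minus_eis_def uminus_eis_def times_eis_def)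

lemma of_nat_eis: "of_nat n = Eis (int n) 0"
  by (induction n) (auto simp: eis_eq_iff)

lemma of_int_eis: "of_int k = Eis k 0"
  by (cases k rule: int_cases2) (auto simp: of_nat_eis eis_eq_iff)

lemma eis_of_int_sel [simp]: "ere (of_int k) = k" "eim (of_int k) = 0"
  by (auto simp: of_int_eis)

definition enorm :: "eis \<Rightarrow> int" where
  "enorm x = (ere x)\<^sup>2 - ere x * eim x + (eim x)\<^sup>2"

definition ecnj :: "eis \<Rightarrow> eis" where
  "ecnj x = Eis (ere x - eim x) (- eim x)"

lemma ecnj_sel [simp]: "ere (ecnj x) = ere x - eim x" "eim (ecnj x) = - eim x"
  by (auto simp: ecnj_def)

lemma ecnj_mult: "ecnj (x * y) = ecnj x * ecnj y"
  by (auto simp: eis_eq_iff algebra_simps)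

lemma ecnj_add: "ecnj (x + y) = ecnj x + ecnj y"
  by (auto simp: eis_eq_iff algebra_simps)

lemma ecnj_0 [simp]: "ecnj 0 = 0" and ecnj_1 [simp]: "ecnj 1 = 1"
  by (auto simp: eis_eq_iff)

lemma ecnj_ecnj [simp]: "ecnj (ecnj x) = x"
  by (auto simp: eis_eq_iff)

lemma ecnj_sum: "ecnj (sum f A) = (\<Sum>x\<in>A. ecnj (f x))"
  by (induction A rule: infinite_finite_induct) (auto simp: ecnj_add)

lemma mult_ecnj: "x * ecnj x = of_int (enorm x)"
  by (auto simp: eis_eq_iff enorm_def algebra_simps power2_eq_square)

lemma enorm_mult: "enorm (x * y) = enorm x * enorm y"
  by (simp add: enorm_def power2_eq_square algebra_simps)

text \<open>Completing the square makes positive definiteness visible; hence only 0 has norm 0 and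
  the ring has no zero divisors.\<close>

lemma four_enorm: "4 * enorm x = (2 * ere x - eim x)\<^sup>2 + 3 * (eim x)\<^sup>2"
  by (simp add: enorm_def power2_eq_square algebra_simps)

lemma enorm_eq_0_iff [simp]: "enorm x = 0 \<longleftrightarrow> x = 0"
proof
  assume "enorm x = 0"
  hence *: "(2 * ere x - eim x)\<^sup>2 + 3 * (eim x)\<^sup>2 = 0"
    using four_enorm[of x] by simp
  have "(eim x)\<^sup>2 = 0" "(2 * ere x - eim x)\<^sup>2 = 0"
    using * zero_le_power2[of "eim x"] zero_le_power2[of "2 * ere x - eim x"] by linarith+
  thus "x = 0"
    by (auto simp: eis_eq_iff)
qed (auto simp: enorm_def)

instance eis :: idom
proof
  fix x y :: eis assume "x \<noteq> 0" "y \<noteq> 0"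
  hence "enorm (x * y) \<noteq> 0"
    by (simp add: enorm_mult)
  thus "x * y \<noteq> 0"
    by (metis enorm_eq_0_iff)
qed

lemma of_int_dvd_eis_iff: "of_int q dvd x \<longleftrightarrow> q dvd ere x \<and> q dvd eim x"
proof
  assume "of_int q dvd x"
  thus "q dvd ere x \<and> q dvd eim x"
    by (auto elim!: dvdE)
next
  assume "q dvd ere x \<and> q dvd eim x"
  then obtain a b where "ere x = q * a" "eim x = q * b"
    by (auto elim!: dvdE)
  hence "x = of_int q * Eis a b"
    by (auto simp: eis_eq_iff)
  thus "of_int q dvd x" by simp
qed

definition omega :: eis where "omega = Eis 0 1"

lemma omega_neq_0: "omega \<noteq> 0"
  by (simp add: omega_def zero_eis_def)

lemma omega_power3: "omega ^ 3 = 1"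
  by (simp add: omega_def eis_eq_iff power3_eq_cube)

lemma omega_power_mod3: "omega ^ (n mod 3) = omega ^ n"
  by (metis mult.right_neutral omega_power3 power_mult power_one div_mult_mod_eq power_add mult.commute)

lemma omega_power_eq_1_iff: "omega ^ n = 1 \<longleftrightarrow> 3 dvd n"
proof -
  have "n mod 3 = 0 \<or> n mod 3 = 1 \<or> n mod 3 = 2" by linarith
  moreover have "omega ^ 1 \<noteq> 1" "omega ^ 2 \<noteq> 1"
    by (auto simp: omega_def eis_eq_iff power2_eq_square)
  ultimately have "omega ^ (n mod 3) = 1 \<longleftrightarrow> n mod 3 = 0" by auto
  thus ?thesis by (auto simp: omega_power_mod3)
qed

lemma eis_cube_root_of_unity:
  assumes "u ^ 3 = (1 :: eis)"
  shows   "u = 1 \<or> u = omega \<or> u = omega\<^sup>2"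
proof -
  have "(u - 1) * (u - omega) * (u - omega\<^sup>2) = u ^ 3 - 1"
    by (simp add: omega_def eis_eq_iff power2_eq_square power3_eq_cube algebra_simps)
  thus ?thesis using assms by auto
qed

lemma eis_cube_root_of_unity_cnj:
  assumes "u ^ 3 = (1 :: eis)"
  shows   "ecnj u = u\<^sup>2"
  using eis_cube_root_of_unity[OF assms]
  by (auto simp: omega_def eis_eq_iff power2_eq_square)

text \<open>Both \<open>omega - 1\<close> and \<open>omega ^ 2 - 1\<close> have a coordinate that is
  1 or -1, so no \<open>q > 1\<close> divides them. This turns congruences of character values into
  equalities.\<close>

lemma eis_cube_root_of_unity_cong:
  assumes "u ^ 3 = (1 :: eis)" "of_int q dvd (u - 1)" "q > 1"
  shows   "u = 1"
  using eis_cube_root_of_unity[OF assms(1)] assms(2-)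
  by (auto simp: omega_def eis_eq_iff power2_eq_square of_int_dvd_eis_iff)

section \<open>The Frobenius map modulo a prime\<close>

text \<open>The inner binomial coefficients vanish modulo \<open>q\<close>. The ring is left general
  because the congruence serves both Eisenstein integers and polynomials over them.\<close>

lemma frobenius_add_dvd:
  fixes x y :: "'a :: comm_ring_1"
  assumes "prime q"
  shows   "of_nat q dvd ((x + y) ^ q - (x ^ q + y ^ q))"
proof -
  have "q > 0" using assms prime_gt_0_nat by blast
  have "(x + y) ^ q = (\<Sum>k\<le>q. of_nat (q choose k) * x ^ k * y ^ (q - k))"
    by (rule binomial_ring)
  also have "{..q} = {0, q} \<union> ({..q} - {0, q})" by auto
  also have "(\<Sum>k\<in>{0, q} \<union> ({..q} - {0, q}). of_nat (q choose k) * x ^ k * y ^ (q - k))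
     = (x ^ q + y ^ q) + (\<Sum>k\<in>{..q}-{0,q}. of_nat (q choose k) * x ^ k * y ^ (q - k))"
    using \<open>q > 0\<close> by (subst sum.union_disjoint) (auto simp: add_ac)
  finally have "(x + y) ^ q - (x ^ q + y ^ q) =
      (\<Sum>k\<in>{..q}-{0,q}. of_nat (q choose k) * x ^ k * y ^ (q - k))"
    by simp
  moreover have "of_nat q dvd (of_nat (q choose k) * x ^ k * y ^ (q - k) :: 'a)"
    if "k \<in> {..q}-{0,q}" for k
  proof -
    have "q dvd (q choose k)"
      using that assms by (intro dvd_choose_prime) auto
    thus ?thesis
      by (metis dvd_mult2 of_nat_dvd_iff dvdE dvd_triv_left of_nat_mult)
  qed
  ultimately show ?thesis
    by (simp only:) (rule dvd_sum)
qed

lemma dvd_diff_power: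
  fixes x y :: "'a :: comm_ring_1"
  assumes "c dvd (x - y)"
  shows   "c dvd (x ^ n - y ^ n)"
proof -
  have "(x - y) dvd (x ^ n - y ^ n)"
    by (metis power_diff_sumr2 dvd_triv_left)
  thus ?thesis using assms dvd_trans by blast
qed

lemma frobenius_sum_dvd:
  fixes f :: "'b \<Rightarrow> 'a :: comm_ring_1"
  assumes "prime q"
  shows   "of_nat q dvd ((\<Sum>i\<in>A. f i) ^ q - (\<Sum>i\<in>A. f i ^ q))"
proof (induction A rule: infinite_finite_induct)
  case (insert i A)
  have "of_nat q dvd ((f i + sum f A) ^ q - (f i ^ q + sum f A ^ q)) + (sum f A ^ q - (\<Sum>i\<in>A. f i ^ q))"
    by (rule dvd_add) (use insert.IH frobenius_add_dvd[OF assms] in auto)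
  thus ?case using insert.hyps by (simp add: algebra_simps)
qed (use assms in \<open>auto simp: power_0_left prime_gt_0_nat\<close>)

lemma frobenius2_sum_dvd:
  fixes f :: "'b \<Rightarrow> 'a :: comm_ring_1"
  assumes "prime q"
  shows   "of_nat q dvd ((\<Sum>i\<in>A. f i) ^ (q\<^sup>2) - (\<Sum>i\<in>A. f i ^ (q\<^sup>2)))"
proof -
  have "of_nat q dvd (((\<Sum>i\<in>A. f i) ^ q) ^ q - (\<Sum>i\<in>A. f i ^ q) ^ q)
       + ((\<Sum>i\<in>A. f i ^ q) ^ q - (\<Sum>i\<in>A. (f i ^ q) ^ q))"
    by (intro dvd_add dvd_diff_power frobenius_sum_dvd assms)
  thus ?thesis by (simp add: power2_eq_square power_mult)
qed

lemma int_fermat_dvd: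
  assumes "prime q"
  shows   "int q dvd (a ^ q - a)"
proof (cases "int q dvd a")
  case True
  thus ?thesis using assms
    by (metis dvd_diff dvd_power_same dvd_trans dvd_power prime_gt_0_nat)
next
  case False
  define b where "b = nat (a mod int q)"
  have q: "q > 0" using assms prime_gt_0_nat by blast
  have ab: "[a = int b] (mod int q)"
    using q by (simp add: b_def Cong.cong_def)
  have "\<not> q dvd b"
    using False ab by (metis cong_dvd_iff int_dvd_int_iff)
  hence "[b ^ (q - 1) = 1] (mod q)"
    using assms fermat_theorem by blast
  hence "[b ^ (q - 1) * b = 1 * b] (mod q)" by (rule cong_scalar_right)
  hence "[b ^ q = b] (mod q)" using q by (metis mult_1 power_minus_mult)
  hence "[int b ^ q = int b] (mod int q)" by (metis cong_int_iff of_nat_power)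
  hence "[a ^ q = a] (mod int q)"
    using ab by (meson cong_pow cong_sym cong_trans)
  thus ?thesis by (simp add: cong_iff_dvd_diff)
qed

text \<open>So \<open>(q\<^sup>2 - 1) div 3\<close> is an exact quotient and raising to the power
  \<open>q\<^sup>2\<close> fixes cube roots of unity.\<close>

lemma prime_square_mod_3:
  assumes "prime q" "q \<noteq> (3 :: nat)"
  shows   "q\<^sup>2 mod 3 = 1"
proof -
  have "prime (3 :: nat)" by simp
  hence "\<not> 3 dvd q" using assms
    by (metis primes_dvd_imp_eq)
  hence "q mod 3 = 1 \<or> q mod 3 = 2" by presburger
  thus ?thesis
    by (auto simp: power2_eq_square mod_mult_eq[of q 3 q, symmetric])
qed

text \<open>The residue ring modulo \<open>q\<close> is a field with \<open>q\<^sup>2\<close> elements or a product of two fields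
  with \<open>q\<close> elements; the exponent \<open>q\<^sup>2\<close> serves both cases.\<close>

lemma eis_fermat_dvd:
  assumes "prime q" "q \<noteq> 3"
  shows   "of_nat q dvd (x ^ (q\<^sup>2) - (x :: eis))"
proof -
  \<comment> \<open>Indexing the two coordinates of \<open>x\<close> by booleans makes
    \<open>x\<close> a sum to which the Frobenius congruence applies.\<close>
  define f where "f = (\<lambda>b. if b then of_int (ere x) else of_int (eim x) * omega)"
  have x: "x = (\<Sum>b\<in>(UNIV :: bool set). f b)"
    by (simp add: UNIV_bool omega_def eis_eq_iff f_def)
  have om: "omega ^ (q\<^sup>2) = omega"
    using prime_square_mod_3[OF assms] omega_power_mod3[of "q\<^sup>2"] by simp
  have int: "of_nat q dvd (of_int a ^ (q\<^sup>2) - (of_int a :: eis))" for a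
  proof -
    have "int q dvd ((a ^ q) ^ q - a ^ q) + (a ^ q - a)"
      by (intro dvd_add int_fermat_dvd assms)
    hence "int q dvd (a ^ (q\<^sup>2) - a)"
      by (simp add: power2_eq_square power_mult)
    then obtain k where "a ^ (q\<^sup>2) - a = int q * k" ..
    hence "of_int (a ^ (q\<^sup>2) - a) = (of_nat q * of_int k :: eis)"
      by (metis of_int_mult of_int_of_nat_eq)
    thus ?thesis by auto
  qed
  have "of_nat q dvd (f b ^ (q\<^sup>2) - f b)" for b
  proof (cases b)
    case False
    have "f b ^ (q\<^sup>2) - f b = (of_int (eim x) ^ (q\<^sup>2) - of_int (eim x)) * omega"
      using False by (simp add: f_def power_mult_distrib om algebra_simps)
    thus ?thesis using int by (metis dvd_mult2)
  qed (auto simp: f_def int)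
  hence "of_nat q dvd (\<Sum>b\<in>UNIV. f b ^ (q\<^sup>2) - f b)"
    by (intro dvd_sum)
  hence "of_nat q dvd ((\<Sum>b\<in>UNIV. f b) ^ (q\<^sup>2) - (\<Sum>b\<in>UNIV. f b ^ (q\<^sup>2)))
          + (\<Sum>b\<in>UNIV. f b ^ (q\<^sup>2) - f b)"
    using frobenius2_sum_dvd[OF assms(1)] by (intro dvd_add)
  thus ?thesis unfolding x by (simp add: sum_subtractf)
qed

section \<open>Cubic Gauss and Jacobi sums\<close>

lemma sum_shift_mod:
  fixes h :: "int \<Rightarrow> 'a :: comm_monoid_add"
  assumes per: "\<And>t. h (t mod m) = h t" and "m > 0"
  shows   "(\<Sum>t\<in>{0..<m}. h (t + c)) = (\<Sum>t\<in>{0..<m}. h t)"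
  by (rule sum.reindex_bij_witness[of _ "\<lambda>t. (t - c) mod m" "\<lambda>t. (t + c) mod m"])
     (use \<open>m > 0\<close> in \<open>auto simp: mod_simps per\<close>)

lemma sum_scale_mod:
  fixes h :: "int \<Rightarrow> 'a :: comm_monoid_add"
  assumes per: "\<And>t. h (t mod m) = h t" and "m > 0" and "coprime c m"
  shows   "(\<Sum>t\<in>{0..<m}. h (c * t)) = (\<Sum>t\<in>{0..<m}. h t)"
proof -
  obtain d where d: "[c * d = 1] (mod m)"
    using cong_solve_coprime_int[OF \<open>coprime c m\<close>] by blast
  have *: "(c * (d * t)) mod m = t mod m" for t
    using cong_scalar_right[OF d, of t] by (simp add: Cong.cong_def mult.assoc)
  show ?thesis
    by (rule sum.reindex_bij_witness[of _ "\<lambda>t. (d * t) mod m" "\<lambda>t. (c * t) mod m"])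
       (use \<open>m > 0\<close> in \<open>auto simp: mod_simps per * mult.left_commute[of d c]\<close>)
qed

text \<open>Values in \<open>eis\<close> rather than in the complex numbers make the Jacobi sum an
  Eisenstein integer by construction and give meaning to congruences modulo
  \<open>q\<close>.\<close>

locale cubic_character =
  fixes p :: nat and \<chi> :: "int \<Rightarrow> eis"
  assumes prime_p: "prime p"
    and chi_mod: "\<And>a. \<chi> (a mod int p) = \<chi> a"
    and chi_mult: "\<And>a b. \<chi> (a * b) = \<chi> a * \<chi> b"
    and chi_eq_0_iff: "\<And>a. \<chi> a = 0 \<longleftrightarrow> int p dvd a"
    and chi_cube: "\<And>a. \<not> int p dvd a \<Longrightarrow> \<chi> a ^ 3 = 1"
    and chi_nontrivial: "\<exists>c. \<not> int p dvd c \<and> \<chi> c \<noteq> 1"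
begin

section \<open>Character values, convolutions and the Jacobi sum\<close>

lemma p_gt_1: "p > 1"
  using prime_p prime_gt_1_nat by blast

lemma coprime_p_iff: "coprime c (int p) \<longleftrightarrow> \<not> int p dvd c"
  using prime_p by (metis coprime_commute prime_imp_coprime prime_int_nat_transfer
      coprime_absorb_left not_prime_unit prime_nat_int_transfer)

lemma chi_1 [simp]: "\<chi> 1 = 1"
proof -
  have "\<chi> 1 * (\<chi> 1 - 1) = 0"
    using chi_mult[of 1 1] by (simp add: algebra_simps)
  moreover have "\<chi> 1 \<noteq> 0"
    using p_gt_1 by (simp add: chi_eq_0_iff)
  ultimately show ?thesis by simp
qed

text \<open>The order of \<open>\<chi> (-1)\<close> divides both 2 and 3.\<close>

lemma chi_minus: "\<chi> (- a) = \<chi> a"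
proof -
  have "\<chi> (-1) ^ 2 = 1"
    using chi_mult[of "-1" "-1"] by (simp add: power2_eq_square)
  moreover have "\<chi> (-1) ^ 3 = 1"
    using p_gt_1 by (intro chi_cube) auto
  ultimately have "\<chi> (-1) = 1"
    by (simp add: power3_eq_cube power2_eq_square)
  thus ?thesis using chi_mult[of "-1" a] by simp
qed

lemma chi_power: "\<chi> (a ^ n) = \<chi> a ^ n"
  by (induction n) (auto simp: chi_mult)

lemma ecnj_chi: "ecnj (\<chi> a) = \<chi> a ^ 2"
proof (cases "int p dvd a")
  case False
  thus ?thesis by (intro eis_cube_root_of_unity_cnj chi_cube)
qed (auto simp: chi_eq_0_iff[THEN iffD2])

lemma chi_mult_ecnj: "\<chi> a * ecnj (\<chi> a) = (if int p dvd a then 0 else 1)"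
  using chi_cube[of a] by (auto simp: ecnj_chi chi_eq_0_iff power2_eq_square power3_eq_cube mult.assoc)

lemma sum_chi: "(\<Sum>t\<in>{0..<int p}. \<chi> t) = 0"
proof -
  obtain c where c: "\<not> int p dvd c" "\<chi> c \<noteq> 1"
    using chi_nontrivial by blast
  have "(\<Sum>t\<in>{0..<int p}. \<chi> t) = (\<Sum>t\<in>{0..<int p}. \<chi> (c * t))"
    using c p_gt_1 by (subst sum_scale_mod) (auto simp: chi_mod coprime_p_iff)
  also have "\<dots> = \<chi> c * (\<Sum>t\<in>{0..<int p}. \<chi> t)"
    by (simp add: chi_mult sum_distrib_left)
  finally have "(1 - \<chi> c) * (\<Sum>t\<in>{0..<int p}. \<chi> t) = 0"
    by (simp add: algebra_simps)
  thus ?thesis using c by simp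
qed

lemma sum_ecnj_chi: "(\<Sum>t\<in>{0..<int p}. ecnj (\<chi> t)) = 0"
  by (simp flip: ecnj_sum add: sum_chi)

text \<open>Convolution on the residues modulo \<open>p\<close>, which is multiplication in the
  group ring. As \<open>s - t\<close> leaves the range of summation, \<open>h\<close> is meant to be
  periodic.\<close>

definition conv :: "(int \<Rightarrow> eis) \<Rightarrow> (int \<Rightarrow> eis) \<Rightarrow> int \<Rightarrow> eis" where
  "conv f h s = (\<Sum>t\<in>{0..<int p}. f t * h (s - t))"

definition jacobi :: eis where "jacobi = conv \<chi> \<chi> 1"

text \<open>Substitute \<open>s * t\<close> for \<open>t\<close>; in the applications
  \<open>u\<close> and \<open>v\<close> are the values of the two characters at
  \<open>s\<close>.\<close>

lemma conv_scale:
  assumes f: "\<And>t. f (t mod int p) = f t" "\<And>t. f (s * t) = u * f t"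
    and h: "\<And>t. h (t mod int p) = h t" "\<And>t. h (s * t) = v * h t"
    and s: "\<not> int p dvd s"
  shows "conv f h s = u * v * conv f h 1"
proof -
  have per: "f (t mod int p) * h (s - t mod int p) = f t * h (s - t)" for t
    by (metis f(1) h(1) mod_diff_right_eq)
  have "conv f h s = (\<Sum>t\<in>{0..<int p}. f (s * t) * h (s - s * t))"
    unfolding conv_def using s p_gt_1
    by (subst sum_scale_mod) (auto simp: per coprime_p_iff)
  also have "\<dots> = (\<Sum>t\<in>{0..<int p}. u * v * (f t * h (1 - t)))"
  proof (rule sum.cong)
    fix t
    have "h (s - s * t) = v * h (1 - t)"
      using h(2)[of "1 - t"] by (simp add: algebra_simps)
    thus "f (s * t) * h (s - s * t) = u * v * (f t * h (1 - t))"
      by (simp add: f(2))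
  qed auto
  finally show ?thesis by (simp add: conv_def sum_distrib_left)
qed

text \<open>Scaling gives the factor \<open>\<chi> s ^ 2\<close>, the conjugate of
  \<open>\<chi> s\<close>. For \<open>s\<close> divisible by \<open>p\<close> the convolution is the
  sum of all \<open>\<chi> t ^ 2\<close>, which is 0, so one formula covers both cases.\<close>

lemma conv_chi_chi: "conv \<chi> \<chi> s = jacobi * ecnj (\<chi> s)"
proof (cases "int p dvd s")
  case False
  have "conv \<chi> \<chi> s = \<chi> s * \<chi> s * conv \<chi> \<chi> 1"
    by (rule conv_scale) (auto simp: chi_mod chi_mult False)
  thus ?thesis by (simp add: jacobi_def ecnj_chi power2_eq_square)
next
  case True
  have "\<chi> (s - t) = \<chi> t" for t
  proof -
    have "\<chi> (s - t) = \<chi> ((s - t) mod int p)" by (simp add: chi_mod)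
    also have "(s - t) mod int p = (- t) mod int p"
      using True by (metis diff_0 dvd_imp_mod_0 mod_diff_left_eq)
    finally show ?thesis by (simp add: chi_mod chi_minus)
  qed
  hence "conv \<chi> \<chi> s = (\<Sum>t\<in>{0..<int p}. ecnj (\<chi> t))"
    by (simp add: conv_def ecnj_chi power2_eq_square)
  thus ?thesis using True chi_eq_0_iff[of s] by (simp add: sum_ecnj_chi)
qed

lemma conv_ecnj_ecnj: "conv (\<lambda>t. ecnj (\<chi> t)) (\<lambda>t. ecnj (\<chi> t)) s = ecnj jacobi * \<chi> s"
proof -
  have "conv (\<lambda>t. ecnj (\<chi> t)) (\<lambda>t. ecnj (\<chi> t)) s = ecnj (conv \<chi> \<chi> s)"
    by (simp add: conv_def ecnj_sum ecnj_mult)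
  thus ?thesis by (simp add: conv_chi_chi ecnj_mult)
qed

text \<open>The common value of this convolution at the nonzero residues is found by summing
  over all residues, which gives \<open>0\<close>.\<close>

lemma conv_chi_ecnj:
  "conv \<chi> (\<lambda>t. ecnj (\<chi> t)) s = (if int p dvd s then of_nat p else 0) - 1"
proof -
  define c where "c = conv \<chi> (\<lambda>t. ecnj (\<chi> t))"
  have c0: "c s = of_nat p - 1" if "int p dvd s" for s
  proof -
    have "\<chi> (s - t) = \<chi> t" for t
    proof -
      have "\<chi> (s - t) = \<chi> ((s - t) mod int p)" by (simp add: chi_mod)
      also have "(s - t) mod int p = (- t) mod int p"
        using that by (metis diff_0 dvd_imp_mod_0 mod_diff_left_eq)
      finally show ?thesis by (simp add: chi_mod chi_minus)
    qed
    hence "c s = (\<Sum>t\<in>{0..<int p}. if int p dvd t then 0 else 1)"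
      by (simp add: c_def conv_def chi_mult_ecnj)
    also have "{0..<int p} = insert 0 {1..<int p}"
      using p_gt_1 by auto
    also have "(\<Sum>t\<in>insert 0 {1..<int p}. if int p dvd t then 0 else 1 :: eis) = (\<Sum>t\<in>{1..<int p}. 1)"
      proof (subst sum.insert)
      have "(\<Sum>t\<in>{1..<int p}. if int p dvd t then 0 else 1) = (\<Sum>t\<in>{1..<int p}. 1 :: eis)"
        by (intro sum.cong) (auto dest: zdvd_imp_le)
      thus "(if int p dvd 0 then 0 else 1) + (\<Sum>t\<in>{1..<int p}. if int p dvd t then 0 else 1)
            = (\<Sum>t\<in>{1..<int p}. 1 :: eis)" by simp
    qed auto
    also have "\<dots> = of_nat p - 1"
      using p_gt_1 by (simp add: of_nat_diff)
    finally show ?thesis .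
  qed
  have c1: "c s = c 1" if "\<not> int p dvd s" for s
  proof -
    have "c s = \<chi> s * ecnj (\<chi> s) * c 1"
      unfolding c_def
      by (rule conv_scale) (auto simp: chi_mod chi_mult ecnj_mult that)
    thus ?thesis using that by (simp add: chi_mult_ecnj)
  qed
  have "(\<Sum>s\<in>{0..<int p}. c s) = (\<Sum>t\<in>{0..<int p}. \<Sum>s\<in>{0..<int p}. \<chi> t * ecnj (\<chi> (s - t)))"
    unfolding c_def conv_def by (rule sum.swap)
  also have "\<dots> = (\<Sum>t\<in>{0..<int p}. \<chi> t * (\<Sum>s\<in>{0..<int p}. ecnj (\<chi> (s + - t))))"
    by (simp add: sum_distrib_left)
  also have "\<dots> = 0"
    using p_gt_1 by (subst sum_shift_mod) (auto simp: chi_mod sum_ecnj_chi)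
  finally have "(\<Sum>s\<in>{0..<int p}. c s) = 0" .
  moreover have "{0..<int p} = insert 0 {1..<int p}"
    using p_gt_1 by auto
  ultimately have "c 0 + (\<Sum>s\<in>{1..<int p}. c s) = 0"
    by simp
  also have "(\<Sum>s\<in>{1..<int p}. c s) = (\<Sum>s\<in>{1..<int p}. c 1)"
    using zdvd_imp_le by (intro sum.cong c1) fastforce+
  also have "\<dots> = (of_nat p - 1) * c 1"
    using p_gt_1 by (simp add: of_nat_diff)
  finally have "(of_nat p - 1) * (1 + c 1) = 0"
    using c0[of 0] by (simp add: algebra_simps)
  moreover have "of_nat p - 1 \<noteq> (0 :: eis)"
    using p_gt_1 by (auto simp: of_nat_eis eis_eq_iff)
  ultimately have "c 1 = -1"
    by (simp add: eq_neg_iff_add_eq_0 add.commute)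
  thus ?thesis using c0 c1 by (auto simp: c_def)
qed

text \<open>A formal Gauss sum: the indeterminate takes the place of a primitive \<open>p\<close>-th
  root of unity.\<close>

definition gpoly :: "(int \<Rightarrow> eis) \<Rightarrow> eis poly" where
  "gpoly f = (\<Sum>t\<in>{0..<int p}. monom (f t) (nat t))"

text \<open>The group ring of the additive group modulo \<open>p\<close> is the polynomial ring modulo
  $X^p - 1$.\<close>

definition gmod :: "eis poly" where "gmod = monom 1 p - 1"

definition geq :: "eis poly \<Rightarrow> eis poly \<Rightarrow> bool"  (infix \<open>\<sim>\<close> 50) where
  "geq u v \<longleftrightarrow> gmod dvd (u - v)"

section \<open>Congruences in the group ring\<close>

lemma geq_refl [simp]: "u \<sim> u"
  by (simp add: geq_def)

lemma geq_sym: "u \<sim> v \<Longrightarrow> v \<sim> u"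
  unfolding geq_def by (metis dvd_minus_iff minus_diff_eq)

lemma geq_trans [trans]: "u \<sim> v \<Longrightarrow> v \<sim> w \<Longrightarrow> u \<sim> w"
  unfolding geq_def by (metis dvd_add diff_add_cancel add_diff_eq)

lemma geq_mult:
  assumes "u \<sim> v" "u' \<sim> v'"
  shows   "u * u' \<sim> v * v'"
proof -
  have "u * u' - v * v' = (u - v) * u' + v * (u' - v')"
    by (simp add: algebra_simps)
  thus ?thesis using assms by (auto simp: geq_def)
qed

lemma geq_add: "u \<sim> v \<Longrightarrow> u' \<sim> v' \<Longrightarrow> u + u' \<sim> v + v'"
  unfolding geq_def by (metis add_diff_add dvd_add)

lemma geq_sum: "(\<And>i. i \<in> A \<Longrightarrow> f i \<sim> h i) \<Longrightarrow> sum f A \<sim> sum h A"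
  by (simp add: geq_def flip: sum_subtractf) (rule dvd_sum)

lemma geq_power: "u \<sim> v \<Longrightarrow> u ^ n \<sim> v ^ n"
  by (induction n) (auto intro: geq_mult)

lemma monom_geq_mod: "monom c n \<sim> monom c (n mod p)"
proof -
  have "monom 1 p \<sim> 1"
    by (simp add: geq_def gmod_def)
  hence "monom 1 p ^ (n div p) * monom c (n mod p) \<sim> 1 ^ (n div p) * monom c (n mod p)"
    by (intro geq_mult geq_power) auto
  thus ?thesis by (simp add: monom_power mult_monom)
qed

lemma coeff_gpoly: "i < p \<Longrightarrow> coeff (gpoly f) i = f (int i)"
proof -
  assume i: "i < p"
  have "coeff (gpoly f) i = (\<Sum>t\<in>{0..<int p}. if t = int i then f t else 0)"
    unfolding gpoly_def coeff_sum by (intro sum.cong) auto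
  thus ?thesis using i by simp
qed

text \<open>After the exponents of \<open>u\<close> are reduced modulo \<open>p\<close>, all degrees
  are below \<open>p = degree gmod\<close>, so congruence is equality and the coefficients at
  exponent 1 can be compared. The case \<open>q = 0\<close> yields exact equality.\<close>

lemma geq_gpoly_cong:
  assumes "gpoly f \<sim> gpoly h + of_nat q * u"
  shows   "of_nat q dvd (f 1 - h 1)"
proof -
  define u' where "u' = (\<Sum>i\<le>degree u. monom (coeff u i) (i mod p))"
  have "u = (\<Sum>i\<le>degree u. monom (coeff u i) i)"
    by (simp add: poly_as_sum_of_monoms)
  also have "\<dots> \<sim> u'"
    unfolding u'_def by (intro geq_sum monom_geq_mod)
  finally have "of_nat q * u \<sim> of_nat q * u'"
    by (intro geq_mult) auto
  hence "gpoly f \<sim> gpoly h + of_nat q * u'"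
    using assms geq_add geq_refl geq_trans by blast
  hence dvd: "gmod dvd (gpoly f - (gpoly h + of_nat q * u'))"
    by (simp add: geq_def)
  have deg: "degree gmod = p"
    using p_gt_1 unfolding gmod_def
    using degree_add_eq_left[of "-1" "monom (1 :: eis) p"] by (simp add: degree_monom_eq)
  have "degree (gpoly k) < p" for k
    unfolding gpoly_def using p_gt_1
    by (intro degree_sum_less) (auto intro: le_less_trans[OF degree_monom_le])
  moreover have "degree u' < p"
    unfolding u'_def using p_gt_1
    by (intro degree_sum_less) (auto intro: le_less_trans[OF degree_monom_le])
  hence "degree (of_nat q * u') < p"
    by (rule le_less_trans[rotated]) (metis add_0 degree_mult_le degree_of_nat)
  ultimately have "degree (gpoly f - (gpoly h + of_nat q * u')) < p"
    by (intro degree_diff_less degree_add_less)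
  hence "gpoly f - (gpoly h + of_nat q * u') = 0"
    using dvd deg dvd_imp_degree_le by fastforce
  hence "coeff (gpoly f) 1 = coeff (gpoly h + of_nat q * u') 1"
    by simp
  thus ?thesis
    using p_gt_1 by (simp add: coeff_gpoly of_nat_poly)
qed

text \<open>Collect the terms whose exponents add up to \<open>s\<close> modulo \<open>p\<close>;
  periodicity of \<open>h\<close> permits the shift of the inner sum.\<close>

lemma gpoly_mult:
  assumes "\<And>t. h (t mod int p) = h t"
  shows   "gpoly f * gpoly h \<sim> gpoly (conv f h)"
proof -
  define k where "k = (\<lambda>t u. monom (f t * h u) (nat ((t + u) mod int p)))"
  have k: "k t (u mod int p) = k t u" for t u
    by (simp add: k_def assms mod_simps)
  have "gpoly f * gpoly h =
          (\<Sum>t\<in>{0..<int p}. \<Sum>u\<in>{0..<int p}. monom (f t * h u) (nat t + nat u))"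
    by (simp add: gpoly_def sum_product mult_monom)
  also have "\<dots> \<sim> (\<Sum>t\<in>{0..<int p}. \<Sum>u\<in>{0..<int p}. k t u)"
  proof (intro geq_sum)
    fix t u assume "t \<in> {0..<int p}" "u \<in> {0..<int p}"
    hence "nat ((t + u) mod int p) = (nat t + nat u) mod p"
      by (simp add: nat_mod_distrib nat_add_distrib)
    thus "monom (f t * h u) (nat t + nat u) \<sim> k t u"
      unfolding k_def by (metis monom_geq_mod)
  qed
  also have "(\<Sum>t\<in>{0..<int p}. \<Sum>u\<in>{0..<int p}. k t u) =
             (\<Sum>t\<in>{0..<int p}. \<Sum>s\<in>{0..<int p}. k t (s + - t))"
    using p_gt_1 by (subst sum_shift_mod) (auto simp: k)
  also have "\<dots> = (\<Sum>s\<in>{0..<int p}. \<Sum>t\<in>{0..<int p}. k t (s + - t))"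
    by (rule sum.swap)
  also have "\<dots> = gpoly (conv f h)"
    unfolding gpoly_def conv_def k_def
    by (intro sum.cong) (auto simp: monom_sum)
  finally show ?thesis .
qed

lemma gpoly_scale: "gpoly (\<lambda>s. c * f s) = [:c:] * gpoly f"
  unfolding gpoly_def sum_distrib_left by (simp add: smult_monom)

text \<open>Multiplication by the indeterminate only permutes the coefficients of the all-ones
  element, so only the coefficient sum of the other factor matters.\<close>

lemma gpoly_1_mult:
  "gpoly f * gpoly (\<lambda>_. 1) \<sim> [:\<Sum>t\<in>{0..<int p}. f t:] * gpoly (\<lambda>_. 1)"
proof -
  have "gpoly f * gpoly (\<lambda>_. 1) \<sim> gpoly (conv f (\<lambda>_. 1))"
    by (rule gpoly_mult) auto
  also have "conv f (\<lambda>_. 1) = (\<lambda>_. (\<Sum>t\<in>{0..<int p}. f t) * 1)"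
    by (simp add: conv_def fun_eq_iff)
  also have "gpoly \<dots> = [:\<Sum>t\<in>{0..<int p}. f t:] * gpoly (\<lambda>_. 1)"
    by (rule gpoly_scale)
  finally show ?thesis .
qed

section \<open>Gauss sum identities and cubic reciprocity\<close>

abbreviation "gsum \<equiv> gpoly \<chi>"
abbreviation "gsum_cnj \<equiv> gpoly (\<lambda>t. ecnj (\<chi> t))"
abbreviation "gtriv \<equiv> gpoly (\<lambda>_. 1)"

lemma gsum_square: "gsum * gsum \<sim> [:jacobi:] * gsum_cnj"
proof -
  have "gsum * gsum \<sim> gpoly (conv \<chi> \<chi>)"
    by (rule gpoly_mult) (rule chi_mod)
  also have "conv \<chi> \<chi> = (\<lambda>s. jacobi * ecnj (\<chi> s))"
    by (rule ext) (rule conv_chi_chi)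
  finally show ?thesis by (simp only: gpoly_scale)
qed

lemma gsum_cnj_square: "gsum_cnj * gsum_cnj \<sim> [:ecnj jacobi:] * gsum"
proof -
  have "gsum_cnj * gsum_cnj \<sim> gpoly (conv (\<lambda>t. ecnj (\<chi> t)) (\<lambda>t. ecnj (\<chi> t)))"
    by (rule gpoly_mult) (simp add: chi_mod)
  also have "conv (\<lambda>t. ecnj (\<chi> t)) (\<lambda>t. ecnj (\<chi> t)) = (\<lambda>s. ecnj jacobi * \<chi> s)"
    by (rule ext) (rule conv_ecnj_ecnj)
  finally show ?thesis by (simp only: gpoly_scale)
qed

lemma gpoly_diff: "gpoly (\<lambda>s. f s - h s) = gpoly f - gpoly h"
  unfolding gpoly_def sum_subtractf[symmetric] diff_monom ..

lemma gpoly_at_0: "gpoly (\<lambda>s. if int p dvd s then c else 0) = [:c:]"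
proof -
  have "gpoly (\<lambda>s. if int p dvd s then c else 0) = (\<Sum>t\<in>{0..<int p}. if t = 0 then [:c:] else 0)"
    unfolding gpoly_def by (intro sum.cong) (auto dest: zdvd_imp_le simp: monom_0)
  thus ?thesis using p_gt_1 by simp
qed

text \<open>The group ring form of the fact that a Gauss sum has absolute value
  \<open>sqrt p\<close>. The term \<open>gtriv\<close> would vanish at a primitive
  \<open>p\<close>-th root of unity; here it stays, but a further factor \<open>gsum\<close> kills
  it.\<close>

lemma gsum_mult_cnj: "gsum * gsum_cnj \<sim> [:of_nat p:] - gtriv"
proof -
  have "gsum * gsum_cnj \<sim> gpoly (conv \<chi> (\<lambda>t. ecnj (\<chi> t)))"
    by (rule gpoly_mult) (simp add: chi_mod)
  also have "conv \<chi> (\<lambda>t. ecnj (\<chi> t)) = (\<lambda>s. (if int p dvd s then of_nat p else 0) - 1)"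
    by (rule ext) (rule conv_chi_ecnj)
  also have "gpoly \<dots> = [:of_nat p:] - gtriv"
    by (simp only: gpoly_diff gpoly_at_0)
  finally show ?thesis .
qed

lemma gtriv_square: "gtriv * gtriv \<sim> [:of_nat p:] * gtriv"
  using gpoly_1_mult[of "\<lambda>_. 1"] by simp

lemma gsum_mult_triv: "gsum * gtriv \<sim> 0"
  using gpoly_1_mult[of \<chi>] by (simp add: sum_chi)

text \<open>The product of the squares of \<open>gsum\<close> and \<open>gsum_cnj\<close> is
  evaluated in two ways. With \<open>d\<close> for the product \<open>gsum * gsum_cnj\<close>, the
  first gives the norm of \<open>jacobi\<close> times \<open>d\<close>, the second
  \<open>d * d\<close>, which is \<open>p\<close> times \<open>d\<close> by
  \<open>gtriv_square\<close>. The coefficient \<open>d 1 = -1\<close> can be cancelled.\<close>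

lemma enorm_jacobi: "enorm jacobi = int p"
proof -
  define d where "d = (\<lambda>s. (if int p dvd s then of_nat p else 0) - 1 :: eis)"
  have d: "gpoly d = [:of_nat p:] - gtriv"
    unfolding d_def by (simp only: gpoly_diff gpoly_at_0)
  have "gpoly (\<lambda>s. (jacobi * ecnj jacobi) * d s) = [:jacobi * ecnj jacobi:] * gpoly d"
    by (rule gpoly_scale)
  also have "\<dots> \<sim> [:jacobi * ecnj jacobi:] * (gsum * gsum_cnj)"
    unfolding d by (intro geq_mult geq_refl geq_sym[OF gsum_mult_cnj])
  also have "\<dots> = ([:jacobi:] * gsum_cnj) * ([:ecnj jacobi:] * gsum)"
    by (simp add: mult_ac)
  also have "\<dots> \<sim> (gsum * gsum) * (gsum_cnj * gsum_cnj)"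
    by (intro geq_mult geq_sym[OF gsum_square] geq_sym[OF gsum_cnj_square])
  also have "\<dots> = (gsum * gsum_cnj) * (gsum * gsum_cnj)"
    by (simp only: mult_ac)
  also have "\<dots> \<sim> gpoly d * gpoly d"
    unfolding d by (intro geq_mult gsum_mult_cnj)
  also have "\<dots> = gtriv * gtriv + ([:of_nat p:] * [:of_nat p:] - 2 * [:of_nat p:] * gtriv)"
    unfolding d by (simp only: algebra_simps) simp
  also have "\<dots> \<sim> [:of_nat p:] * gtriv + ([:of_nat p:] * [:of_nat p:] - 2 * [:of_nat p:] * gtriv)"
    by (intro geq_add gtriv_square geq_refl)
  also have "\<dots> = [:of_nat p:] * gpoly d"
    unfolding d by (simp only: algebra_simps) simp
  also have "\<dots> = gpoly (\<lambda>s. of_nat p * d s)"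
    by (rule gpoly_scale[symmetric])
  finally have "gpoly (\<lambda>s. (jacobi * ecnj jacobi) * d s) \<sim> gpoly (\<lambda>s. of_nat p * d s) + of_nat 0 * 0"
    by simp
  from geq_gpoly_cong[OF this] have "(jacobi * ecnj jacobi) * d 1 = of_nat p * d 1"
    by simp
  moreover have "d 1 = -1"
    using p_gt_1 by (simp add: d_def)
  ultimately have "of_int (enorm jacobi) = (of_nat p :: eis)"
    by (simp add: mult_ecnj)
  thus ?thesis
    by (simp add: of_int_eis of_nat_eis)
qed

text \<open>Each cube of \<open>gsum\<close> contributes \<open>p * jacobi\<close>. The exponent is
  \<open>3 * m + 1\<close> because the spare factor \<open>gsum\<close> annihilates the terms with
  \<open>gtriv\<close>.\<close>

lemma gsum_power: "gsum ^ (3 * m + 1) \<sim> [:(of_nat p * jacobi) ^ m:] * gsum"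
proof (induction m)
  case (Suc m)
  have "gsum ^ (3 * Suc m + 1) = gsum ^ (3 * m + 1) * ((gsum * gsum) * gsum)"
  proof -
    have "3 * Suc m + 1 = (3 * m + 1) + 3" by simp
    thus ?thesis by (simp only: power_add power3_eq_cube)
  qed
  also have "\<dots> \<sim> ([:(of_nat p * jacobi) ^ m:] * gsum) * (([:jacobi:] * gsum_cnj) * gsum)"
    by (intro geq_mult Suc.IH gsum_square geq_refl)
  also have "\<dots> = [:(of_nat p * jacobi) ^ m * jacobi:] * gsum * (gsum * gsum_cnj)"
    by (simp add: mult_ac)
  also have "\<dots> \<sim> [:(of_nat p * jacobi) ^ m * jacobi:] * gsum * ([:of_nat p:] - gtriv)"
    by (intro geq_mult gsum_mult_cnj geq_refl)
  also have "\<dots> = [:(of_nat p * jacobi) ^ Suc m:] * gsum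
                   + [:- ((of_nat p * jacobi) ^ m * jacobi):] * (gsum * gtriv)"
    by (simp add: algebra_simps smult_diff_right)
  also have "\<dots> \<sim> [:(of_nat p * jacobi) ^ Suc m:] * gsum
                   + [:- ((of_nat p * jacobi) ^ m * jacobi):] * 0"
    by (intro geq_add geq_mult gsum_mult_triv geq_refl)
  finally show ?case by simp
qed auto

text \<open>Modulo \<open>q\<close>, Frobenius turns \<open>gsum ^ Q\<close> with
  \<open>Q = q\<^sup>2\<close> into the same sum with exponents multiplied by \<open>Q\<close>, and
  reindexing by \<open>Q * t\<close> shows that \<open>\<chi> Q\<close> times it is
  \<open>gsum\<close>. Comparison with \<open>gsum_power\<close> gives the claim.\<close>

lemma gauss_cong:
  assumes "prime q" "q \<noteq> 3" "q \<noteq> p"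
  shows   "of_nat q dvd (\<chi> (int q) ^ 2 * (of_nat p * jacobi) ^ ((q\<^sup>2 - 1) div 3) - 1)"
proof -
  define Q where "Q = q\<^sup>2"
  define m where "m = (Q - 1) div 3"
  have Q: "Q = 3 * m + 1"
    using prime_square_mod_3[OF assms(1,2)] unfolding m_def Q_def by presburger
  have "\<not> int p dvd int q"
    using assms prime_p by (metis int_dvd_int_iff primes_dvd_imp_eq)
  hence cop: "coprime (int Q) (int p)"
    using prime_p by (simp add: coprime_p_iff Q_def prime_dvd_power_iff)
  have chiQ: "\<chi> t ^ Q = \<chi> t" for t
    using chi_cube[of t] by (cases "int p dvd t")
      (auto simp: Q power_mult chi_eq_0_iff[THEN iffD2])
  have chiQ_Q: "\<chi> (int q) ^ 2 = \<chi> (int Q)"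
    by (simp add: Q_def chi_power)
  define S where "S = (\<Sum>t\<in>{0..<int p}. monom (\<chi> t) (nat t) ^ Q)"
  have S: "[:\<chi> (int Q):] * S \<sim> gsum"
  proof -
    have "[:\<chi> (int Q):] * S = (\<Sum>t\<in>{0..<int p}. monom (\<chi> (int Q * t)) (nat t * Q))"
      unfolding S_def sum_distrib_left
      by (intro sum.cong refl) (simp add: smult_monom monom_power chiQ chi_mult chiQ_Q)
    also have "\<dots> \<sim> (\<Sum>t\<in>{0..<int p}. monom (\<chi> (int Q * t)) (nat ((int Q * t) mod int p)))"
    proof (intro geq_sum)
      fix t assume "t \<in> {0..<int p}"
      hence "nat ((int Q * t) mod int p) = (nat t * Q) mod p"
        by (simp add: nat_mod_distrib nat_mult_distrib mult.commute)
      thus "monom (\<chi> (int Q * t)) (nat t * Q) \<sim> monom (\<chi> (int Q * t)) (nat ((int Q * t) mod int p))"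
        by (metis monom_geq_mod)
    qed
    also have "\<dots> = (\<Sum>t\<in>{0..<int p}. monom (\<chi> t) (nat (t mod int p)))"
      using p_gt_1 cop
      by (subst sum_scale_mod[where h = "\<lambda>t. monom (\<chi> t) (nat (t mod int p))"]) (auto simp: chi_mod)
    also have "\<dots> = gsum"
      by (auto simp: gpoly_def)
    finally show ?thesis .
  qed
  have "of_nat q dvd (gsum ^ Q - S)"
    unfolding gpoly_def S_def Q_def by (rule frobenius2_sum_dvd) fact
  then obtain u where "gsum ^ Q - S = of_nat q * u" ..
  hence u: "gsum ^ Q = S + of_nat q * u"
    by (simp add: algebra_simps)
  have "gpoly (\<lambda>s. (\<chi> (int Q) * (of_nat p * jacobi) ^ m) * \<chi> s)
          = [:\<chi> (int Q):] * ([:(of_nat p * jacobi) ^ m:] * gsum)"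
    unfolding gpoly_scale by (simp add: mult.commute)
  also have "\<dots> \<sim> [:\<chi> (int Q):] * gsum ^ Q"
    unfolding Q by (intro geq_mult geq_refl geq_sym[OF gsum_power])
  also have "\<dots> = [:\<chi> (int Q):] * S + of_nat q * ([:\<chi> (int Q):] * u)"
    unfolding u by (simp only: algebra_simps)
  also have "\<dots> \<sim> gsum + of_nat q * ([:\<chi> (int Q):] * u)"
    by (intro geq_add geq_refl S)
  finally have "of_nat q dvd ((\<chi> (int Q) * (of_nat p * jacobi) ^ m) * \<chi> 1 - \<chi> 1)"
    by (rule geq_gpoly_cong)
  thus ?thesis
    by (simp add: Q_def m_def chi_power)
qed

text \<open>To cancel \<open>x\<close> in Fermat's congruence, multiply by its conjugate: the norm
  is invertible modulo \<open>q\<close>.\<close>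

lemma eis_euler_dvd:
  assumes "prime q" "q \<noteq> 3" "\<not> int q dvd enorm x"
  shows   "of_nat q dvd (x ^ (q\<^sup>2 - 1) - 1)"
proof -
  define y where "y = x ^ (q\<^sup>2 - 1) - 1"
  have "q\<^sup>2 > 0" using assms(1) prime_gt_0_nat by simp
  hence "x ^ (q\<^sup>2) = x * x ^ (q\<^sup>2 - 1)"
    by (simp flip: power_Suc)
  hence "x * y = x ^ (q\<^sup>2) - x"
    by (simp add: y_def algebra_simps)
  hence "of_nat q dvd x * y"
    using eis_fermat_dvd[OF assms(1,2)] by simp
  hence "of_nat q dvd ecnj x * (x * y)"
    by (rule dvd_mult)
  also have "ecnj x * (x * y) = of_int (enorm x) * y"
    by (simp add: mult_ecnj flip: mult.assoc mult.commute[of x])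
  finally have "of_int (int q) dvd (of_int (enorm x) * y)"
    by simp
  hence "int q dvd enorm x * ere y" "int q dvd enorm x * eim y"
    unfolding of_int_dvd_eis_iff by auto
  hence "int q dvd ere y" "int q dvd eim y"
    using assms by (auto simp: prime_dvd_mult_iff)
  hence "of_int (int q) dvd y"
    by (subst of_int_dvd_eis_iff) auto
  thus ?thesis by (simp add: y_def)
qed

lemma cubic_reciprocity:
  assumes q: "prime q" "q \<noteq> 3" "q \<noteq> p"
    and im: "int q dvd eim (jacobi * x ^ 3)" and x: "\<not> int q dvd enorm x"
  shows   "\<chi> (int q) = 1"
proof -
  define N where "N = (q\<^sup>2 - 1) div 3"
  have N: "q\<^sup>2 - 1 = 3 * N"
    using prime_square_mod_3[OF q(1,2)] unfolding N_def by presburger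
  let ?u = "of_nat p * jacobi"
  have pJ: "of_nat p = jacobi * ecnj jacobi"
    by (simp add: mult_ecnj enorm_jacobi)
  \<comment> \<open>The difference of \<open>z\<close> and its conjugate has the coordinates
    \<open>eim z\<close> and \<open>2 * eim z\<close>.\<close>
  have "of_int (int q) dvd (jacobi * x ^ 3 - ecnj (jacobi * x ^ 3))"
    using im by (subst of_int_dvd_eis_iff) (simp flip: mult_2 del: eis_sel(11,12))
  hence "of_nat q dvd jacobi ^ 2 * (jacobi * x ^ 3 - ecnj (jacobi * x ^ 3))"
    by simp
  also have "jacobi ^ 2 * (jacobi * x ^ 3 - ecnj (jacobi * x ^ 3)) = (jacobi * x) ^ 3 - ?u * ecnj x ^ 3"
    unfolding pJ by (simp add: ecnj_mult power2_eq_square power3_eq_cube algebra_simps)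
  finally have "of_nat q dvd (((jacobi * x) ^ 3) ^ N - (?u * ecnj x ^ 3) ^ N)"
    by (rule dvd_diff_power)
  hence 1: "of_nat q dvd ((jacobi * x) ^ (q\<^sup>2 - 1) - ?u ^ N * ecnj x ^ (q\<^sup>2 - 1))"
    by (simp only: N power_mult power_mult_distrib)
  have "\<not> int q dvd int p"
    using q prime_p by (metis int_dvd_int_iff primes_dvd_imp_eq)
  hence "\<not> int q dvd enorm (jacobi * x)"
    using x q by (simp add: enorm_mult enorm_jacobi prime_dvd_mult_iff)
  hence 2: "of_nat q dvd ((jacobi * x) ^ (q\<^sup>2 - 1) - 1)"
    using q by (intro eis_euler_dvd)
  have "enorm (ecnj x) = enorm x"
    by (simp add: enorm_def power2_eq_square algebra_simps)
  hence 3: "of_nat q dvd (ecnj x ^ (q\<^sup>2 - 1) - 1)"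
    using q x by (intro eis_euler_dvd) auto
  have 4: "of_nat q dvd (\<chi> (int q) ^ 2 * ?u ^ N - 1)"
    unfolding N_def by (intro gauss_cong q)
  define A B C D where "A = (jacobi * x) ^ (q\<^sup>2 - 1)" "B = ?u ^ N" "C = ecnj x ^ (q\<^sup>2 - 1)"
    "D = \<chi> (int q) ^ 2"
  \<comment> \<open>Modulo \<open>q\<close>, \<open>A\<close> and \<open>C\<close> are 1 and
    \<open>A = B * C\<close>, so \<open>B = 1\<close>; with \<open>D * B = 1\<close> this leaves
    \<open>D = 1\<close>.\<close>
  have "D - 1 = (D * B - 1) + D * ((A - B * C) - (A - 1) + B * (C - 1))"
    by (simp add: algebra_simps)
  also have "of_nat q dvd \<dots>"
    by (rule dvd_add[OF 4[folded A_B_C_D_def] dvd_mult[OF dvd_add[OF dvd_diff[OF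
          1[folded A_B_C_D_def] 2[folded A_B_C_D_def]] dvd_mult[OF 3[folded A_B_C_D_def]]]]])
  finally have dvd: "of_int (int q) dvd (\<chi> (int q) ^ 2 - 1)"
    by (simp add: A_B_C_D_def)
  have c3: "\<chi> (int q) ^ 3 = 1"
    using q prime_p by (intro chi_cube) (metis int_dvd_int_iff primes_dvd_imp_eq)
  hence "(\<chi> (int q) ^ 2) ^ 3 = 1"
    by (metis power_mult mult.commute power_one)
  moreover have "int q > 1"
    using prime_gt_1_nat[OF q(1)] by simp
  ultimately have "\<chi> (int q) ^ 2 = 1"
    using dvd by (metis eis_cube_root_of_unity_cong)
  moreover have "\<chi> (int q) ^ 3 = \<chi> (int q) ^ 2 * \<chi> (int q)"
    by (simp add: power3_eq_cube power2_eq_square)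
  ultimately show ?thesis
    using c3 by simp
qed

end

text \<open>The character sends \<open>g ^ i\<close> to \<open>omega ^ i\<close> for a primitive
  root \<open>g\<close>. Its value is 1 exactly when 3 divides the index, which exhibits a
  cube.\<close>

lemma cubic_character_exists:
  assumes p: "prime p" "[p = 1] (mod 3)"
  obtains \<chi> where "cubic_character p \<chi>" "\<And>a. \<chi> a = 1 \<Longrightarrow> cubic_residue (int p) a"
proof -
  have p1: "p > 1" using p prime_gt_1_nat by blast
  have dvd3: "3 dvd (p - 1)"
    using p(2) p1 by (metis cong_to_1_nat)
  obtain g where g: "residue_primroot p g"
    using prime_primitive_root_exists[of p] p p1 by auto
  have ord: "ord p g = p - 1" and cop: "coprime p g"
    using g p by (auto simp: residue_primroot_def totient_prime)
  have ex: "\<exists>i. [a = int g ^ i] (mod int p)" if "\<not> int p dvd a" for a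
  proof -
    define b where "b = nat (a mod int p)"
    have ab: "int b = a mod int p"
      using p1 by (simp add: b_def)
    have "b \<noteq> 0"
      using that ab by (metis dvd_eq_mod_eq_0 of_nat_0)
    moreover have "int b < int p"
      using ab p1 by simp
    ultimately have "b > 0" "b < p"
      by auto
    hence "b \<in> totatives p"
      using p by (auto simp: totatives_prime)
    also have "totatives p = (\<lambda>i. g ^ i mod p) ` {..<totient p}"
      using residue_primroot_is_generator[OF p1 g] by (simp add: bij_betw_def)
    finally obtain i where "b = g ^ i mod p" by auto
    hence "[b = g ^ i] (mod p)" by (simp add: Cong.cong_def)
    hence "[int b = int g ^ i] (mod int p)"
      by (metis cong_int_iff of_nat_power)
    thus ?thesis
      using ab by (auto simp: Cong.cong_def)
  qed
  define ind where "ind = (\<lambda>a. SOME i. [a = int g ^ i] (mod int p))"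
  have ind: "[a = int g ^ ind a] (mod int p)" if "\<not> int p dvd a" for a
    unfolding ind_def by (rule someI_ex) (rule ex[OF that])
  define \<chi> where "\<chi> = (\<lambda>a. if int p dvd a then 0 else omega ^ ind a)"
  \<comment> \<open>The index is an arbitrary choice, but it is determined modulo
    \<open>p - 1\<close>, hence modulo 3.\<close>
  have chi_eq: "\<chi> a = omega ^ i" if "[a = int g ^ i] (mod int p)" for a i
  proof -
    have "coprime (int g ^ i) (int p)"
      using cop by (simp add: coprime_commute)
    hence "coprime a (int p)"
      using that by (metis cong_imp_coprime cong_sym)
    hence ndvd: "\<not> int p dvd a"
      using p1 by (metis coprime_absorb_right int_dvd_int_iff nat_dvd_1_iff_1 less_irrefl of_nat_1)
    have "[int g ^ ind a = int g ^ i] (mod int p)"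
      using ind[OF ndvd] that by (meson cong_sym cong_trans)
    hence "[g ^ ind a = g ^ i] (mod p)"
      by (metis cong_int_iff of_nat_power)
    hence "[ind a = i] (mod (p - 1))"
      using order_divides_expdiff[OF cop] ord by simp
    hence "[ind a = i] (mod 3)"
      using dvd3 cong_dvd_modulus_nat by blast
    hence "omega ^ ind a = omega ^ i"
      by (metis Cong.cong_def omega_power_mod3)
    thus ?thesis using ndvd by (simp add: \<chi>_def)
  qed
  have "cubic_character p \<chi>"
  proof
    show "\<chi> (a mod int p) = \<chi> a" for a
    proof (cases "int p dvd a")
      case False
      have "[a mod int p = int g ^ ind a] (mod int p)"
        using ind[OF False] by (simp add: Cong.cong_def)
      from chi_eq[OF this] show ?thesis using False by (simp add: \<chi>_def)
    qed (auto simp: \<chi>_def dvd_mod_iff)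
    show "\<chi> (a * b) = \<chi> a * \<chi> b" for a b
    proof (cases "int p dvd a \<or> int p dvd b")
      case False
      hence "[a * b = int g ^ (ind a + ind b)] (mod int p)"
        using ind by (simp add: power_add cong_mult)
      from chi_eq[OF this] show ?thesis using False by (simp add: \<chi>_def power_add)
    qed (auto simp: \<chi>_def)
    show "\<chi> a = 0 \<longleftrightarrow> int p dvd a" for a
      using omega_neq_0 by (auto simp: \<chi>_def)
    show "\<chi> a ^ 3 = 1" if "\<not> int p dvd a" for a
    proof -
      have "(omega ^ ind a) ^ 3 = (omega ^ 3) ^ ind a"
        by (metis power_mult mult.commute)
      thus ?thesis using that by (simp add: \<chi>_def omega_power3)
    qed
    have "\<chi> (int g) = omega"
      using chi_eq[of "int g" 1] by simp
    moreover have "omega \<noteq> 1" by (auto simp: omega_def one_eis_def)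
    moreover have "\<not> int p dvd int g"
    proof
      assume "int p dvd int g"
      hence "p dvd g" by simp
      hence "is_unit p" using cop by (simp add: coprime_absorb_left)
      thus False using p1 by simp
    qed
    ultimately show "\<exists>c. \<not> int p dvd c \<and> \<chi> c \<noteq> 1"
      by (intro exI[of _ "int g"]) simp
    show "prime p" by (rule p(1))
  qed
  moreover have "cubic_residue (int p) a" if "\<chi> a = 1" for a
  proof -
    have ndvd: "\<not> int p dvd a"
      using that by (auto simp: \<chi>_def)
    hence "omega ^ ind a = 1"
      using that by (simp add: \<chi>_def)
    then obtain k where k: "ind a = 3 * k"
      by (auto simp: omega_power_eq_1_iff)
    have "int g ^ ind a = (int g ^ k) ^ 3"
      unfolding k by (metis power_mult mult.commute)
    hence cong: "[a = (int g ^ k) ^ 3] (mod int p)"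
      using ind[OF ndvd] by simp
    moreover have "\<not> int p dvd int g ^ k"
    proof -
      have "\<not> int p dvd (int g ^ k) ^ 3"
        using ndvd cong_dvd_iff[OF cong] by simp
      thus ?thesis by (metis dvd_mult2 power3_eq_cube)
    qed
    ultimately show ?thesis
      unfolding cubic_residue_def by blast
  qed
  ultimately show ?thesis using that by blast
qed

section \<open>The binary cubic form attached to a Jacobi sum\<close>

lemma ex_four_distinct:
  assumes "card S > 3"
  obtains x1 x2 x3 x4 where "{x1, x2, x3, x4} \<subseteq> S"
    "x1 \<noteq> x2" "x1 \<noteq> x3" "x1 \<noteq> x4" "x2 \<noteq> x3" "x2 \<noteq> x4" "x3 \<noteq> x4"
proof -
  have "4 \<le> card S" using assms by simp
  then obtain T where T: "T \<subseteq> S" "card T = 4"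
    by (metis obtain_subset_with_card_n)
  from T(2) have "card T = Suc 3" by simp
  then obtain x1 T1 where 1: "T = insert x1 T1" "x1 \<notin> T1" "card T1 = 3"
    by (metis card_Suc_eq)
  obtain x2 x3 x4 where 2: "T1 = {x2, x3, x4}" "x2 \<noteq> x3" "x3 \<noteq> x4" "x2 \<noteq> x4"
    using 1(3) by (auto simp: card_3_iff)
  show ?thesis
    by (rule that[of x1 x2 x3 x4]) (use T 1 2 in auto)
qed

text \<open>Stated for every \<open>q\<close> with the divisibility property of primes, so that it also covers
  \<open>q = 0\<close>, where divisibility by \<open>q\<close> means being zero. The proof takes divided differences.\<close>

lemma cubic_four_roots:
  fixes q c0 c1 c2 c3 :: int
  defines "F \<equiv> \<lambda>x. c3 * x ^ 3 + c2 * x\<^sup>2 + c1 * x + c0"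
  assumes q: "\<And>x y. q dvd x * y \<Longrightarrow> q dvd x \<or> q dvd y"
    and roots: "q dvd F x1" "q dvd F x2" "q dvd F x3" "q dvd F x4"
    and diff: "\<not> q dvd x1 - x2" "\<not> q dvd x1 - x3" "\<not> q dvd x1 - x4"
      "\<not> q dvd x2 - x3" "\<not> q dvd x2 - x4" "\<not> q dvd x3 - x4"
  shows "q dvd c3" "q dvd c2" "q dvd c1"
proof -
  define B where "B = (\<lambda>x y. c3 * (x\<^sup>2 + x * y + y\<^sup>2) + c2 * (x + y) + c1)"
  define C where "C = (\<lambda>x y z. c3 * (x + y + z) + c2)"
  have FB: "F x - F y = (x - y) * B x y" for x y
    by (simp add: F_def B_def power2_eq_square power3_eq_cube algebra_simps)
  have BC: "B x y - B x z = (y - z) * C x y z" for x y z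
    by (simp add: B_def C_def power2_eq_square algebra_simps)
  have B: "q dvd B x y" if "q dvd F x" "q dvd F y" "\<not> q dvd x - y" for x y
  proof -
    have "q dvd (x - y) * B x y" using that by (simp flip: FB)
    thus ?thesis using q that by blast
  qed
  have C: "q dvd C x y z" if "q dvd B x y" "q dvd B x z" "\<not> q dvd y - z" for x y z
  proof -
    have "q dvd (y - z) * C x y z" using that by (simp flip: BC)
    thus ?thesis using q that by blast
  qed
  have 1: "q dvd C x1 x2 x3" "q dvd C x1 x2 x4"
    using roots diff by (auto intro!: C B)
  have "q dvd C x1 x2 x3 - C x1 x2 x4"
    using 1 by (rule dvd_diff)
  also have "C x1 x2 x3 - C x1 x2 x4 = (x3 - x4) * c3"
    by (simp add: C_def algebra_simps)
  finally show c3: "q dvd c3" using q diff by blast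
  have "q dvd C x1 x2 x3 - c3 * (x1 + x2 + x3)"
    using 1(1) c3 by (intro dvd_diff) auto
  thus c2: "q dvd c2" by (simp add: C_def)
  have "q dvd B x1 x2 - (c3 * (x1\<^sup>2 + x1 * x2 + x2\<^sup>2) + c2 * (x1 + x2))"
    using c2 c3 B[of x1 x2] roots diff by (intro dvd_diff dvd_add) auto
  thus "q dvd c1" by (simp add: B_def)
qed

text \<open>Here \<open>a + b * omega\<close> is to be the Jacobi sum; the study of \<open>F\<close>
  rests on its norm being the prime \<open>p\<close>.\<close>

locale cubic_form =
  fixes p :: nat and a b :: int
  assumes prime_p: "prime p" and p_neq_3: "p \<noteq> 3"
    and norm: "a\<^sup>2 - a * b + b\<^sup>2 = int p"
begin

definition F :: "int \<Rightarrow> int" where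
  "F n = b * n ^ 3 + 3 * (a - b) * n\<^sup>2 + (- 3 * a) * n + b"

lemma eim_cube: "eim (Eis a b * Eis n 1 ^ 3) = F n"
  by (simp add: F_def power3_eq_cube power2_eq_square algebra_simps)

text \<open>The other coordinate: \<open>R n + F n * omega\<close> is
  \<open>(a + b * omega) * (n + omega) ^ 3\<close>.\<close>

definition R :: "int \<Rightarrow> int" where
  "R n = a * (n ^ 3 - 3 * n + 1) - b * (3 * n\<^sup>2 - 3 * n)"

text \<open>Multiplicativity of the norm, where \<open>n + omega\<close> has norm
  \<open>n\<^sup>2 - n + 1\<close>.\<close>

lemma norm_RF: "(R n)\<^sup>2 - R n * F n + (F n)\<^sup>2 = int p * (n\<^sup>2 - n + 1) ^ 3"
  unfolding norm[symmetric] R_def F_def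
  by (simp add: power2_eq_square power3_eq_cube algebra_simps)

text \<open>Multiplying \<open>R n + F n * omega\<close> by the conjugate of
  \<open>a + b * omega\<close> gives \<open>p * (n + omega) ^ 3\<close>; these are its
  coordinates.\<close>

lemma cnj_RF:
  "(a - b) * R n + b * F n = int p * (n ^ 3 - 3 * n + 1)"
  "a * F n - b * R n = int p * (3 * (n * (n - 1)))"
  unfolding norm[symmetric] R_def F_def
  by (simp_all add: power2_eq_square power3_eq_cube algebra_simps)

section \<open>Zeros of the cubic form modulo prime powers\<close>

lemma not_dvd_3:
  assumes "prime q" "q \<noteq> 3"
  shows   "\<not> int q dvd 3"
proof
  assume "int q dvd 3"
  hence "q dvd 3" by presburger
  moreover have "prime (3 :: nat)" by simp
  ultimately show False using assms primes_dvd_imp_eq by blast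
qed

text \<open>These are the coordinates of \<open>(n + omega) ^ 3\<close>. If \<open>n\<close> is 0 or
  1 modulo \<open>q\<close>, the second one is 1 or -1.\<close>

lemma cube_primitive:
  assumes q: "prime q" "q \<noteq> 3"
  shows "\<not> (int q dvd 3 * (n * (n - 1)) \<and> int q dvd n ^ 3 - 3 * n + 1)"
proof
  assume *: "int q dvd 3 * (n * (n - 1)) \<and> int q dvd n ^ 3 - 3 * n + 1"
  have unit: "\<not> int q dvd 1" using prime_gt_1_nat[OF q(1)] by simp
  have "int q dvd n \<or> int q dvd n - 1"
    using * not_dvd_3[OF q] q by (simp add: prime_dvd_mult_iff)
  thus False
  proof
    assume "int q dvd n"
    hence "int q dvd (n ^ 3 - 3 * n + 1) - n * (n\<^sup>2 - 3)"
      using * by (intro dvd_diff) auto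
    also have "\<dots> = 1" by (simp add: power2_eq_square power3_eq_cube algebra_simps)
    finally show False using unit by blast
  next
    assume "int q dvd n - 1"
    hence "int q dvd (n - 1) * (n\<^sup>2 + n - 2) - (n ^ 3 - 3 * n + 1)"
      using * by (intro dvd_diff) auto
    also have "\<dots> = 1" by (simp add: power2_eq_square power3_eq_cube algebra_simps)
    finally show False using unit by blast
  qed
qed

text \<open>Otherwise the square of \<open>q\<close> would divide the prime
  \<open>p\<close>.\<close>

lemma not_dvd_a_b:
  assumes "prime q" "int q dvd a" "int q dvd b"
  shows False
proof -
  obtain a' b' where "a = int q * a'" "b = int q * b'"
    using assms by (auto elim!: dvdE)
  hence "int p = int q * (int q * (a'\<^sup>2 - a' * b' + b'\<^sup>2))"
    unfolding norm[symmetric] by (simp add: power2_eq_square algebra_simps)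
  hence "int q * int q dvd int p"
    by (metis dvd_triv_left mult.assoc)
  hence "q * q dvd p"
    by (metis int_dvd_int_iff of_nat_mult)
  moreover from this have "q dvd p" by (metis dvd_mult_left)
  hence "q = p" using assms prime_p primes_dvd_imp_eq by blast
  ultimately show False
    using prime_gt_1_nat[OF prime_p] by (auto dest!: dvd_imp_le)
qed

text \<open>Otherwise \<open>q\<close> divides \<open>R n\<close> by \<open>norm_RF\<close>, hence
  \<open>p * (n + omega) ^ 3\<close> by \<open>cnj_RF\<close>, contrary to primitivity. This
  supplies the norm hypothesis of \<open>cubic_reciprocity\<close>.\<close>

lemma not_dvd_norm:
  assumes q: "prime q" "q \<noteq> 3" "q \<noteq> p" and F: "int q dvd F n"
  shows "\<not> int q dvd n\<^sup>2 - n + 1"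
proof
  assume *: "int q dvd n\<^sup>2 - n + 1"
  have pq: "prime (int q)" using q by simp
  have "int q dvd int p * (n\<^sup>2 - n + 1) ^ 3 + (R n - F n) * F n"
    using * F by (intro dvd_add dvd_mult) (auto intro: dvd_trans[OF _ dvd_power])
  also have "\<dots> = (R n)\<^sup>2"
    unfolding norm_RF[symmetric] by (simp add: power2_eq_square algebra_simps)
  finally have R: "int q dvd R n"
    using pq prime_dvd_power by blast
  have "int q dvd int p * (n ^ 3 - 3 * n + 1)" "int q dvd int p * (3 * (n * (n - 1)))"
    unfolding cnj_RF[symmetric] using R F by auto
  moreover have "\<not> int q dvd int p"
    using q prime_p by (metis int_dvd_int_iff primes_dvd_imp_eq)
  ultimately show False
    using cube_primitive[OF q(1,2)] pq prime_dvd_mult_iff by blast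
qed

text \<open>If it did, \<open>norm_RF\<close> would give in turn that \<open>p\<close> divides
  \<open>R n\<close>, that \<open>p\<close> divides \<open>n\<^sup>2 - n + 1\<close>, and that the
  square of \<open>p\<close> divides \<open>R n\<close>. By \<open>cnj_RF\<close>, \<open>p\<close>
  would then divide \<open>(n + omega) ^ 3\<close>.\<close>

lemma not_square_dvd_F: "\<not> (int p)\<^sup>2 dvd F n"
proof
  assume F2: "(int p)\<^sup>2 dvd F n"
  hence F1: "int p dvd F n"
    by (metis dvd_mult_left power2_eq_square)
  have pp: "prime (int p)" using prime_p by simp
  have p0: "int p \<noteq> 0" using prime_p by auto
  have sq: "int p * (n\<^sup>2 - n + 1) ^ 3 + (R n - F n) * F n = (R n)\<^sup>2"
    unfolding norm_RF[symmetric] by (simp add: power2_eq_square algebra_simps)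
  have "int p dvd (R n)\<^sup>2"
    unfolding sq[symmetric] using F1 by auto
  hence R1: "int p dvd R n"
    using pp prime_dvd_power by blast
  have "int p * (n\<^sup>2 - n + 1) ^ 3 = (R n)\<^sup>2 - (R n - F n) * F n"
    using sq by simp
  also have "int p * int p dvd \<dots>"
    using R1 F1 F2 by (intro dvd_diff) (auto simp: power2_eq_square intro!: mult_dvd_mono)
  finally have "int p dvd (n\<^sup>2 - n + 1) ^ 3"
    using p0 by simp
  hence N: "int p dvd n\<^sup>2 - n + 1"
    using pp prime_dvd_power by blast
  have 1: "int p * (int p)\<^sup>2 dvd int p * (n\<^sup>2 - n + 1) ^ 3"
    using N by (intro mult_dvd_mono) (auto intro: dvd_trans[OF dvd_power_same[OF N, of 2] le_imp_power_dvd])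
  have 2: "int p * (int p)\<^sup>2 dvd (R n - F n) * F n"
    using F1 F2 R1 by (intro mult_dvd_mono) auto
  have "int p * (int p)\<^sup>2 dvd (R n)\<^sup>2"
    unfolding sq[symmetric] using 1 2 by (rule dvd_add)
  moreover obtain r where r: "R n = int p * r" using R1 ..
  ultimately have "int p dvd r\<^sup>2"
    using p0 by (simp add: power2_eq_square mult_ac)
  hence "int p dvd r"
    using pp prime_dvd_power by blast
  hence R2: "(int p)\<^sup>2 dvd R n"
    by (simp add: r power2_eq_square)
  have "(int p)\<^sup>2 dvd int p * (n ^ 3 - 3 * n + 1)" "(int p)\<^sup>2 dvd int p * (3 * (n * (n - 1)))"
    unfolding cnj_RF[symmetric] using R2 F2 by auto
  hence "int p dvd n ^ 3 - 3 * n + 1" "int p dvd 3 * (n * (n - 1))"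
    using p0 by (simp_all add: power2_eq_square)
  thus False
    using cube_primitive[OF prime_p p_neq_3] by blast
qed

text \<open>The quadratic \<open>G\<close> is a third of the derivative of \<open>F\<close>, and
  \<open>A + G * omega\<close> is \<open>(a + b * omega) * (n + omega)\<^sup>2\<close>. A double
  root makes \<open>q\<close> divide both coordinates and so the norm, against
  \<open>not_dvd_norm\<close>.\<close>

lemma simple_root:
  assumes q: "prime q" "q \<noteq> 3" "q \<noteq> p" and F: "int q dvd F n"
  shows "\<not> int q dvd b * n\<^sup>2 + 2 * (a - b) * n - a"
proof
  define G where "G = b * n\<^sup>2 + 2 * (a - b) * n - a"
  define A where "A = a * (n\<^sup>2 - 1) - b * (2 * n - 1)"
  assume "int q dvd b * n\<^sup>2 + 2 * (a - b) * n - a"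
  hence G: "int q dvd G" by (simp add: G_def)
  have pq: "prime (int q)" using q by simp
  \<comment> \<open>This is the second coordinate of
    \<open>(A + G * omega) * (n + omega)\<close>.\<close>
  have "A = F n - (n - 1) * G"
    by (simp add: F_def G_def A_def power2_eq_square power3_eq_cube algebra_simps)
  hence A: "int q dvd A" using F G by simp
  have "A\<^sup>2 - A * G + G\<^sup>2 = int p * (n\<^sup>2 - n + 1)\<^sup>2"
    unfolding norm[symmetric] A_def G_def by (simp add: power2_eq_square algebra_simps)
  moreover have "int q dvd A\<^sup>2 - A * G + G\<^sup>2"
    using A G by (intro dvd_add dvd_diff) (auto simp: power2_eq_square)
  ultimately have "int q dvd int p * (n\<^sup>2 - n + 1)\<^sup>2" by simp
  moreover have "\<not> int q dvd int p"
    using q prime_p by (metis int_dvd_int_iff primes_dvd_imp_eq)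
  ultimately have "int q dvd n\<^sup>2 - n + 1"
    using pq prime_dvd_mult_iff prime_dvd_power by blast
  thus False using not_dvd_norm[OF q F] by blast
qed

text \<open>Uniqueness in the style of Hensel: as roots are simple, those distinct modulo
  \<open>q ^ e\<close> remain distinct modulo \<open>q\<close>.\<close>

lemma roots_not_cong:
  assumes q: "prime q" "q \<noteq> 3" and e: "e = 1 \<or> q \<noteq> p"
    and F: "int q ^ e dvd F x" "int q ^ e dvd F y" "e > 0"
    and xy: "\<not> int q ^ e dvd x - y"
  shows "\<not> int q dvd x - y"
proof
  assume dvd: "int q dvd x - y"
  hence "q \<noteq> p" using e xy by auto
  have Fy: "int q dvd F y"
    using F by (meson dvd_power dvd_trans)
  define G where "G = b * y\<^sup>2 + 2 * (a - b) * y - a"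
  define B where "B = b * (x\<^sup>2 + x * y + y\<^sup>2) + 3 * (a - b) * (x + y) - 3 * a"
  have "F x - F y = (x - y) * B"
    by (simp add: F_def B_def power2_eq_square power3_eq_cube algebra_simps)
  hence *: "int q ^ e dvd (x - y) * B" using F by (metis dvd_diff)
  have "\<not> int q dvd B"
  proof
    assume "int q dvd B"
    \<comment> \<open>For \<open>x\<close> congruent to \<open>y\<close> the difference quotient
      \<open>B\<close> becomes the derivative \<open>3 * G\<close>.\<close>
    hence "int q dvd B - (x - y) * (b * (x + 2 * y) + 3 * (a - b))"
      using dvd by (intro dvd_diff) auto
    also have "\<dots> = 3 * G"
      by (simp add: B_def G_def power2_eq_square algebra_simps)
    finally have "int q dvd 3 * G" .
    moreover have "\<not> int q dvd G"
      unfolding G_def by (rule simple_root) (use q \<open>q \<noteq> p\<close> Fy in auto)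
    moreover have "\<not> int q dvd 3"
      using q not_dvd_3 by blast
    ultimately show False
      using q by (simp add: prime_dvd_mult_iff)
  qed
  hence "coprime (int q ^ e) B"
    using q by (simp add: prime_imp_coprime)
  hence "int q ^ e dvd x - y"
    using * by (simp add: coprime_dvd_mult_left_iff)
  thus False using xy by blast
qed

text \<open>Hence \<open>F\<close> is a true cubic and takes no value more than three times.\<close>

lemma b_neq_0: "b \<noteq> 0"
proof
  assume "b = 0"
  hence "int p dvd a * a" "int p dvd b" using norm by (auto simp: power2_eq_square)
  hence "int p dvd a" "int p dvd b"
    using prime_p by (auto simp: prime_dvd_mult_iff)
  thus False using not_dvd_a_b prime_p by blast
qed

text \<open>In the chosen progression the powers of 3, modulo which \<open>F\<close> may have many roots, do no
  harm.\<close>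

lemma ex_progression:
  obtains c where "c \<in> {0, 2}" "\<And>m. \<not> 9 dvd F (3 * m + c)"
proof (cases "3 dvd b")
  case False
  have "\<not> 9 dvd F (3 * m + 0)" for m
  proof
    assume "9 dvd F (3 * m + 0)"
    hence "3 dvd F (3 * m) - 3 * (9 * b * m ^ 3 + 9 * (a - b) * m\<^sup>2 - 3 * a * m)"
      by (intro dvd_diff) (auto intro: dvd_trans[of 3 9])
    also have "\<dots> = b"
      by (simp add: F_def power2_eq_square power3_eq_cube algebra_simps)
    finally show False using False by simp
  qed
  thus ?thesis using that[of 0] by simp
next
  case True
  then obtain b' where b: "b = 3 * b'" ..
  have na: "\<not> 3 dvd a"
    using not_dvd_a_b[of 3] True by auto
  \<comment> \<open>Here \<open>F (3 * m + 2)\<close> is \<open>6 * a\<close> modulo 9.\<close>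
  have "\<not> 9 dvd F (3 * m + 2)" for m
  proof
    assume "9 dvd F (3 * m + 2)"
    moreover have "F (3 * m + 2) = 3 * (2 * a + 3 * (b' * (9 * m ^ 3 + 18 * m\<^sup>2 + 12 * m + 3) + a * (3 * m\<^sup>2 + 4 * m)
              - b' * (9 * m\<^sup>2 + 12 * m + 4) - a * m))"
      unfolding F_def unfolding b
      by (simp add: power2_eq_square power3_eq_cube algebra_simps)
    ultimately have "3 * 3 dvd 3 * (2 * a + 3 * (b' * (9 * m ^ 3 + 18 * m\<^sup>2 + 12 * m + 3) + a * (3 * m\<^sup>2 + 4 * m)
              - b' * (9 * m\<^sup>2 + 12 * m + 4) - a * m))"
      by simp
    hence "3 dvd 2 * a + 3 * (b' * (9 * m ^ 3 + 18 * m\<^sup>2 + 12 * m + 3) + a * (3 * m\<^sup>2 + 4 * m)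
              - b' * (9 * m\<^sup>2 + 12 * m + 4) - a * m)"
      by (subst (asm) dvd_times_left_cancel_iff) auto
    hence "3 dvd 2 * a" by (metis dvd_add_left_iff dvd_triv_left)
    thus False using na by presburger
  qed
  thus ?thesis using that[of 2] by simp
qed

text \<open>For \<open>q = 3\<close> the window has three elements if \<open>e = 1\<close>, and
  there are no roots otherwise. Squares of \<open>p\<close> never divide. In the remaining cases the
  roots are incongruent modulo \<open>q\<close>, where a cubic that is not identically zero has at
  most three.\<close>

lemma few_roots:
  assumes c: "\<And>m. \<not> 9 dvd F (3 * m + c)" and q: "prime q" and e: "e > 0"
  shows "card {m \<in> {u..<u + q ^ e}. int (q ^ e) dvd F (3 * int m + c)} \<le> 3"
proof (cases "q = 3")
  case True
  show ?thesis
  proof (cases "e = 1")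
    case True
    have "card {m \<in> {u..<u + q ^ e}. int (q ^ e) dvd F (3 * int m + c)} \<le> card {u..<u + q ^ e}"
      by (rule card_mono) auto
    thus ?thesis using True \<open>q = 3\<close> by simp
  next
    case False
    hence "(3 :: int) ^ 2 dvd 3 ^ e"
      using e by (intro le_imp_power_dvd) auto
    hence "\<not> int (q ^ e) dvd F (3 * int m + c)" for m
      using c[of m] \<open>q = 3\<close> dvd_trans by fastforce
    thus ?thesis by simp
  qed
next
  case q3: False
  show ?thesis
  proof (cases "q = p \<and> e > 1")
    case True
    hence "(int p) ^ 2 dvd int p ^ e"
      by (intro le_imp_power_dvd) auto
    hence "\<not> int (q ^ e) dvd F (3 * int m + c)" for m
      using not_square_dvd_F[of "3 * int m + c"] True by (auto dest: dvd_trans)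
    thus ?thesis by simp
  next
    case False
    hence e': "e = 1 \<or> q \<noteq> p" using e by auto
    show ?thesis
    proof (rule ccontr)
      define S where "S = {m \<in> {u..<u + q ^ e}. int (q ^ e) dvd F (3 * int m + c)}"
      define \<nu> where "\<nu> = (\<lambda>m. 3 * int m + c)"
      assume "\<not> ?thesis"
      hence "card S > 3" by (simp add: S_def)
      then obtain x1 x2 x3 x4 where x: "{x1, x2, x3, x4} \<subseteq> S"
        "x1 \<noteq> x2" "x1 \<noteq> x3" "x1 \<noteq> x4" "x2 \<noteq> x3" "x2 \<noteq> x4" "x3 \<noteq> x4"
        by (rule ex_four_distinct)
      have diff: "\<not> int q dvd \<nu> x - \<nu> y" if "x \<in> S" "y \<in> S" "x \<noteq> y" for x y
      proof (rule roots_not_cong[OF q q3 e'])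
        show "int q ^ e dvd F (\<nu> x)" "int q ^ e dvd F (\<nu> y)"
          using that by (auto simp: S_def \<nu>_def)
        \<comment> \<open>As 3 is invertible, distinct \<open>m\<close> in the window give distinct
          arguments modulo \<open>q ^ e\<close>.\<close>
        have "coprime (int q ^ e) 3"
          using q q3 not_dvd_3 by (simp add: prime_imp_coprime)
        moreover have "\<not> int q ^ e dvd int x - int y"
        proof
          assume "int q ^ e dvd int x - int y"
          hence "\<bar>int q ^ e\<bar> \<le> \<bar>int x - int y\<bar>"
            using that by (intro dvd_imp_le_int) auto
          moreover have "u \<le> x" "x < u + q ^ e" "u \<le> y" "y < u + q ^ e"
            using that by (auto simp: S_def)
          hence "\<bar>int x - int y\<bar> < int (q ^ e)" by linarith
          ultimately show False by simp
        qed
        moreover have "\<nu> x - \<nu> y = 3 * (int x - int y)" by (simp add: \<nu>_def)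
        ultimately show "\<not> int q ^ e dvd \<nu> x - \<nu> y"
          by (metis coprime_dvd_mult_right_iff)
      qed (use e in auto)
      have F: "int q dvd F (\<nu> x)" if "x \<in> S" for x
        using that e unfolding S_def \<nu>_def by (auto intro: dvd_trans[OF dvd_power[of e "int q"]])
      have pq: "int q dvd x * y \<Longrightarrow> int q dvd x \<or> int q dvd y" for x y
        using q by (simp add: prime_dvd_mult_iff)
      have root: "int q dvd b * \<nu> x ^ 3 + 3 * (a - b) * (\<nu> x)\<^sup>2 + (- 3 * a) * \<nu> x + b"
        if "x \<in> S" for x
        using F[OF that] unfolding F_def .
      have xs: "x1 \<in> S" "x2 \<in> S" "x3 \<in> S" "x4 \<in> S"
        using x(1) by auto
      \<comment> \<open>Four roots would make \<open>q\<close> divide the coefficients, hence both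
        \<open>a\<close> and \<open>b\<close>.\<close>
      have *: "int q dvd b" "int q dvd 3 * (a - b)"
        using cubic_four_roots(1,2)[OF pq root[OF xs(1)] root[OF xs(2)] root[OF xs(3)] root[OF xs(4)]
            diff[OF xs(1) xs(2) x(2)] diff[OF xs(1) xs(3) x(3)] diff[OF xs(1) xs(4) x(4)]
            diff[OF xs(2) xs(3) x(5)] diff[OF xs(2) xs(4) x(6)] diff[OF xs(3) xs(4) x(7)]]
        by blast+
      hence "int q dvd a - b"
        using not_dvd_3[OF q q3] pq by blast
      hence "int q dvd (a - b) + b" using * by (intro dvd_add)
      hence "int q dvd a" by simp
      thus False using not_dvd_a_b[OF q] * by blast
    qed
  qed
qed

text \<open>There are at most \<open>2 * Y\<close> such values, each taken at most three times by
  \<open>cubic_four_roots\<close> with modulus 0.\<close>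

lemma card_small_values:
  "card {m. m < M \<and> \<bar>F (3 * int m + c)\<bar> < int Y} \<le> 6 * Y"
proof -
  have le3: "card {m. m < M \<and> F (3 * int m + c) = v} \<le> 3" for v
  proof (rule ccontr)
    define S where "S = {m. m < M \<and> F (3 * int m + c) = v}"
    define \<nu> where "\<nu> = (\<lambda>m. 3 * int m + c)"
    assume "\<not> ?thesis"
    hence "card S > 3" by (simp add: S_def)
    then obtain x1 x2 x3 x4 where x: "{x1, x2, x3, x4} \<subseteq> S"
      "x1 \<noteq> x2" "x1 \<noteq> x3" "x1 \<noteq> x4" "x2 \<noteq> x3" "x2 \<noteq> x4" "x3 \<noteq> x4"
      by (rule ex_four_distinct)
    have root: "0 dvd b * \<nu> x ^ 3 + 3 * (a - b) * (\<nu> x)\<^sup>2 + (- 3 * a) * \<nu> x + (b - v)"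
      if "x \<in> S" for x
      using that by (simp add: S_def F_def \<nu>_def)
    have diff: "\<not> 0 dvd \<nu> x - \<nu> y" if "x \<noteq> y" for x y
      using that by (simp add: \<nu>_def)
    have xs: "x1 \<in> S" "x2 \<in> S" "x3 \<in> S" "x4 \<in> S"
      using x(1) by auto
    have zz: "0 dvd x \<or> 0 dvd y" if "0 dvd x * y" for x y :: int
      using that by simp
    have "0 dvd b"
      using cubic_four_roots(1)[OF zz root[OF xs(1)] root[OF xs(2)] root[OF xs(3)] root[OF xs(4)]
            diff[OF x(2)] diff[OF x(3)] diff[OF x(4)]
            diff[OF x(5)] diff[OF x(6)] diff[OF x(7)]]
      by blast
    thus False using b_neq_0 by simp
  qed
  have "{m. m < M \<and> \<bar>F (3 * int m + c)\<bar> < int Y} =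
        (\<Union>v\<in>{-int Y<..<int Y}. {m. m < M \<and> F (3 * int m + c) = v})"
    by auto
  also have "card \<dots> \<le> (\<Sum>v\<in>{-int Y<..<int Y}. card {m. m < M \<and> F (3 * int m + c) = v})"
    by (rule card_UN_le) auto
  also have "\<dots> \<le> (\<Sum>v\<in>{-int Y<..<int Y}. 3)"
    by (intro sum_mono le3)
  also have "\<dots> \<le> 6 * Y"
    by (simp add: nat_diff_distrib)
  finally show ?thesis .
qed

text \<open>Definiteness of the norm form bounds \<open>a\<close>, \<open>b\<close> and
  \<open>a - b\<close> by \<open>2 * sqrt p\<close>; what remains is the expansion of
  \<open>(n + 1) ^ 3\<close>.\<close>

lemma abs_F_le:
  assumes "n \<ge> 0"
  shows "real_of_int \<bar>F n\<bar> \<le> 2 * sqrt p * (real_of_int n + 1) ^ 3"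
proof -
  have bd: "real_of_int \<bar>x\<bar> \<le> 2 * sqrt p" if "x\<^sup>2 \<le> 4 * int p" for x
  proof -
    have "(real_of_int x)\<^sup>2 \<le> 4 * real p"
    proof -
      have "real_of_int (x\<^sup>2) \<le> real_of_int (4 * int p)"
        using that by (rule of_int_le_iff[THEN iffD2])
      thus ?thesis by simp
    qed
    hence "\<bar>real_of_int x\<bar> \<le> sqrt (4 * real p)"
      using real_sqrt_le_mono[of "(real_of_int x)\<^sup>2"] by simp
    thus ?thesis by (simp add: real_sqrt_mult)
  qed
  have sq: "a\<^sup>2 \<le> 4 * int p" "b\<^sup>2 \<le> 4 * int p" "(a - b)\<^sup>2 \<le> 4 * int p"
  proof -
    have "4 * int p = (2 * b - a)\<^sup>2 + 3 * a\<^sup>2" "4 * int p = (2 * a - b)\<^sup>2 + 3 * b\<^sup>2"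
      "4 * int p = (a + b)\<^sup>2 + 3 * (a - b)\<^sup>2"
      unfolding norm[symmetric] by (simp_all add: power2_eq_square algebra_simps)
    thus "a\<^sup>2 \<le> 4 * int p" "b\<^sup>2 \<le> 4 * int p" "(a - b)\<^sup>2 \<le> 4 * int p"
      using zero_le_power2[of "2 * b - a"] zero_le_power2[of "2 * a - b"] zero_le_power2[of "a + b"]
        zero_le_power2[of a] zero_le_power2[of b] zero_le_power2[of "a - b"] by linarith+
  qed
  define s where "s = 2 * sqrt (real p)"
  have s: "real_of_int \<bar>a\<bar> \<le> s" "real_of_int \<bar>b\<bar> \<le> s" "real_of_int \<bar>a - b\<bar> \<le> s"
    unfolding s_def by (rule bd sq)+
  have "\<bar>F n\<bar> \<le> \<bar>b\<bar> * n ^ 3 + 3 * \<bar>a - b\<bar> * n\<^sup>2 + 3 * \<bar>a\<bar> * n + \<bar>b\<bar>"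
  proof -
    have "\<bar>F n\<bar> \<le> \<bar>b * n ^ 3\<bar> + \<bar>3 * (a - b) * n\<^sup>2\<bar> + \<bar>(- 3 * a) * n\<bar> + \<bar>b\<bar>"
      unfolding F_def by linarith
    thus ?thesis using assms by (simp add: abs_mult del: right_diff_distrib_numeral)
  qed
  hence "real_of_int \<bar>F n\<bar> \<le> real_of_int (\<bar>b\<bar> * n ^ 3 + 3 * \<bar>a - b\<bar> * n\<^sup>2 + 3 * \<bar>a\<bar> * n + \<bar>b\<bar>)"
    by (rule of_int_le_iff[THEN iffD2])
  also have "\<dots> = real_of_int \<bar>b\<bar> * n ^ 3 + 3 * real_of_int \<bar>a - b\<bar> * n\<^sup>2 + 3 * real_of_int \<bar>a\<bar> * n + real_of_int \<bar>b\<bar>"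
    by simp
  also have "\<dots> \<le> s * n ^ 3 + 3 * s * n\<^sup>2 + 3 * s * n + s"
    using assms by (intro add_mono mult_right_mono mult_left_mono s) auto
  also have "\<dots> = s * (real_of_int n + 1) ^ 3"
    by (simp add: power2_eq_square power3_eq_cube algebra_simps)
  finally show ?thesis by (simp add: s_def)
qed

end

section \<open>Integers composed of few primes\<close>

lemma card_prime_powers_dvd:
  fixes n q :: nat
  assumes "prime q" "n > 0"
  shows "card {a \<in> {1..A}. q ^ a dvd n} = min A (multiplicity q n)"
proof -
  have "{a \<in> {1..A}. q ^ a dvd n} = {1..min A (multiplicity q n)}"
    using assms prime_gt_1_nat[OF assms(1)] by (auto simp: power_dvd_iff_le_multiplicity)
  thus ?thesis by simp
qed

lemma sum_card_swap:
  assumes "finite S" "finite T"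
  shows "(\<Sum>m\<in>S. card {a \<in> T. P a m}) = (\<Sum>a\<in>T. card {m \<in> S. P a m})"
proof -
  have "(\<Sum>m\<in>S. card {a \<in> T. P a m}) = (\<Sum>m\<in>S. \<Sum>a\<in>T. if P a m then 1 else 0)"
    using assms by (simp add: sum.If_cases Int_def)
  also have "\<dots> = (\<Sum>a\<in>T. \<Sum>m\<in>S. if P a m then 1 else 0)"
    by (rule sum.swap)
  also have "\<dots> = (\<Sum>a\<in>T. card {m \<in> S. P a m})"
    using assms by (simp add: sum.If_cases Int_def)
  finally show ?thesis .
qed

text \<open>The interval is covered by \<open>H div Q + 1\<close> consecutive windows of length
  \<open>Q\<close>.\<close>

lemma card_windows_le:
  fixes t H Q :: nat
  assumes "\<And>u. card {m \<in> {u..<u + Q}. P m} \<le> c" "Q > 0"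
  shows "card {m \<in> {t..<t + H}. P m} \<le> c * (H div Q + 1)"
proof -
  have le: "card {m \<in> {t..<t + k * Q}. P m} \<le> c * k" for k
  proof (induction k)
    case (Suc k)
    have "{m \<in> {t..<t + Suc k * Q}. P m} =
            {m \<in> {t..<t + k * Q}. P m} \<union> {m \<in> {t + k * Q..<t + k * Q + Q}. P m}"
      by auto
    hence "card {m \<in> {t..<t + Suc k * Q}. P m} \<le>
             card {m \<in> {t..<t + k * Q}. P m} + card {m \<in> {t + k * Q..<t + k * Q + Q}. P m}"
      by (metis card_Un_le)
    thus ?case using Suc assms(1)[of "t + k * Q"] by simp
  qed auto
  have "H < (H div Q + 1) * Q"
    using dividend_less_div_times[of Q H] assms(2) by simp
  hence "card {m \<in> {t..<t + H}. P m} \<le> card {m \<in> {t..<t + (H div Q + 1) * Q}. P m}"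
    by (intro card_mono) auto
  also have "\<dots> \<le> c * (H div Q + 1)" by (rule le)
  finally show ?thesis .
qed

text \<open>One direction of Legendre's formula for the exponent of \<open>q\<close> in
  \<open>H!\<close>, truncated at \<open>A\<close>.\<close>

lemma sum_div_prime_power_le:
  fixes q :: nat
  assumes "prime q"
  shows "(\<Sum>a\<in>{1..A}. H div q ^ a) \<le> multiplicity q (fact H :: nat)"
proof -
  have q: "q > 0" using assms prime_gt_0_nat by blast
  have "(\<Sum>a\<in>{1..A}. H div q ^ a) \<le> (\<Sum>a\<in>{1..A}. card {i \<in> {1..H}. q ^ a dvd i})"
  proof (rule sum_mono)
    fix a
    have "card {1..H div q ^ a} \<le> card {i \<in> {1..H}. q ^ a dvd i}"
    proof (rule card_inj_on_le[of "\<lambda>j. j * q ^ a"])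
      show "inj_on (\<lambda>j. j * q ^ a) {1..H div q ^ a}"
        using q by (auto simp: inj_on_def)
      show "(\<lambda>j. j * q ^ a) ` {1..H div q ^ a} \<subseteq> {i \<in> {1..H}. q ^ a dvd i}"
        using q by (auto simp: less_eq_div_iff_mult_less_eq)
    qed auto
    thus "H div q ^ a \<le> card {i \<in> {1..H}. q ^ a dvd i}" by simp
  qed
  also have "\<dots> = (\<Sum>i\<in>{1..H}. card {a \<in> {1..A}. q ^ a dvd i})"
    by (rule sum_card_swap[symmetric]) auto
  also have "\<dots> \<le> (\<Sum>i\<in>{1..H}. multiplicity q i)"
  proof (rule sum_mono)
    fix i assume "i \<in> {1..H}"
    thus "card {a \<in> {1..A}. q ^ a dvd i} \<le> multiplicity q i"
      by (subst card_prime_powers_dvd[OF assms]) auto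
  qed
  also have "\<dots> = multiplicity q (\<Prod>i\<in>{1..H}. i)"
    using assms by (subst prime_elem_multiplicity_prod_distrib) auto
  also have "(\<Prod>i\<in>{1..H}. i) = (fact H :: nat)"
    by (simp add: fact_prod)
  finally show ?thesis .
qed

lemma prod_prime_power_multiplicity_le:
  fixes n :: nat
  assumes "finite S" "\<And>q. q \<in> S \<Longrightarrow> prime q" "n > 0"
  shows "(\<Prod>q\<in>S. q ^ multiplicity q n) \<le> n"
proof -
  have "(\<Prod>q\<in>S. q ^ multiplicity q n) dvd (\<Prod>q\<in>S \<union> prime_factors n. q ^ multiplicity q n)"
    using assms(1) by (intro prod_dvd_prod_subset) auto
  also have "\<dots> = (\<Prod>q\<in>prime_factors n. q ^ multiplicity q n)"
  proof (intro prod.mono_neutral_right ballI)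
    fix q assume "q \<in> S \<union> prime_factors n - prime_factors n"
    hence "multiplicity q n = 0"
      using assms(2) by (auto simp: prime_factors_multiplicity)
    thus "q ^ multiplicity q n = 1" by simp
  qed (use assms(1) in auto)
  also have "\<dots> = n"
    using assms(3) by (rule prime_factorization_nat[symmetric])
  finally show ?thesis
    using assms(3) by (rule dvd_imp_le)
qed

text \<open>A prime \<open>q\<close> divides the product of the values at most three times as often as it
  divides \<open>H!\<close>, up to an excess of at most 3 for each power \<open>q\<^sup>e \<le> X\<close>.\<close>

lemma prod_le_of_few_roots:
  fixes f :: "nat \<Rightarrow> nat" and X :: real
  assumes f: "\<And>m. m \<in> {t..<t + H} \<Longrightarrow> f m > 0 \<and> real (f m) \<le> X" and X: "X \<ge> 1"
    and few: "\<And>q e u. prime q \<Longrightarrow> e > 0 \<Longrightarrow> card {m \<in> {u..<u + q ^ e}. q ^ e dvd f m} \<le> 3"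
  defines "N \<equiv> (\<Prod>m\<in>{t..<t + H}. f m)"
  shows "real N \<le> real (fact H) ^ 3 * X ^ (3 * card (prime_factors N))"
proof -
  have f0: "f m > 0" if "m \<in> {t..<t + H}" for m
    using f[OF that] by simp
  have zero_notin: "0 \<notin> f ` {t..<t + H}"
    using f0 by force
  have N0: "N > 0" unfolding N_def by (intro prod_pos ballI f0)
  have local: "real (q ^ multiplicity q N) \<le> real (q ^ multiplicity q (fact H :: nat)) ^ 3 * X ^ 3"
    if q: "prime q" for q
  proof -
    \<comment> \<open>The largest exponent of \<open>q\<close> in a single value, so that
      \<open>q ^ A\<close> is at most \<open>X\<close>; the inserted 0 covers an empty
      block.\<close>
    define A where "A = Max (insert 0 ((\<lambda>m. multiplicity q (f m)) ` {t..<t + H}))"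
    have A: "multiplicity q (f m) \<le> A" if "m \<in> {t..<t + H}" for m
      unfolding A_def using that by (intro Max_ge) auto
    have "A \<in> insert 0 ((\<lambda>m. multiplicity q (f m)) ` {t..<t + H})"
      unfolding A_def by (rule Max_in) auto
    hence qA: "real (q ^ A) \<le> X"
    proof
      assume "A \<in> (\<lambda>m. multiplicity q (f m)) ` {t..<t + H}"
      then obtain m where m: "m \<in> {t..<t + H}" "A = multiplicity q (f m)" by auto
      have "q ^ A dvd f m" by (simp add: m multiplicity_dvd)
      hence "q ^ A \<le> f m" using f m by (intro dvd_imp_le) auto
      thus ?thesis using f m by (meson of_nat_le_iff order_trans)
    qed (use X in auto)
    have "multiplicity q N = (\<Sum>m\<in>{t..<t + H}. multiplicity q (f m))"
      unfolding N_def using q zero_notin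
      by (intro prime_elem_multiplicity_prod_distrib) simp_all
    also have "\<dots> = (\<Sum>m\<in>{t..<t + H}. card {a \<in> {1..A}. q ^ a dvd f m})"
    proof (intro sum.cong refl)
      fix m assume m: "m \<in> {t..<t + H}"
      thus "multiplicity q (f m) = card {a \<in> {1..A}. q ^ a dvd f m}"
        using A[OF m] f0[OF m] by (subst card_prime_powers_dvd[OF q]) auto
    qed
    also have "\<dots> = (\<Sum>a\<in>{1..A}. card {m \<in> {t..<t + H}. q ^ a dvd f m})"
      by (rule sum_card_swap) auto
    \<comment> \<open>The \<open>+ 1\<close> accounts for the incomplete last window; over all
      \<open>a\<close> it adds \<open>3 * A\<close> to the exponent, at the cost of a factor
      \<open>X ^ 3\<close>.\<close>
    also have "\<dots> \<le> (\<Sum>a\<in>{1..A}. 3 * (H div q ^ a + 1))"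
      using q by (intro sum_mono card_windows_le few) (auto simp: prime_gt_0_nat)
    also have "\<dots> = 3 * (\<Sum>a\<in>{1..A}. H div q ^ a) + 3 * A"
      by (simp add: sum_distrib_left sum.distrib)
    also have "\<dots> \<le> 3 * multiplicity q (fact H :: nat) + 3 * A"
      using sum_div_prime_power_le[OF q] by simp
    finally have "q ^ multiplicity q N \<le> q ^ (3 * multiplicity q (fact H :: nat) + 3 * A)"
      using q by (intro power_increasing) (auto simp: Suc_le_eq prime_gt_0_nat)
    hence "real (q ^ multiplicity q N) \<le> real (q ^ (3 * multiplicity q (fact H :: nat) + 3 * A))"
      by (rule of_nat_mono)
    also have "\<dots> = real (q ^ multiplicity q (fact H :: nat)) ^ 3 * real (q ^ A) ^ 3"
      by (simp add: power_add power_mult mult.commute[of 3])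
    also have "\<dots> \<le> real (q ^ multiplicity q (fact H :: nat)) ^ 3 * X ^ 3"
      using qA by (intro mult_left_mono power_mono) auto
    finally show ?thesis .
  qed
  let ?PF = "prime_factors N"
  have "real N = (\<Prod>q\<in>?PF. real (q ^ multiplicity q N))"
    using N0 by (subst prime_factorization_nat) auto
  also have "\<dots> \<le> (\<Prod>q\<in>?PF. real (q ^ multiplicity q (fact H :: nat)) ^ 3 * X ^ 3)"
    by (intro prod_mono conjI local) auto
  also have "\<dots> = real (\<Prod>q\<in>?PF. q ^ multiplicity q (fact H :: nat)) ^ 3 * X ^ (3 * card ?PF)"
    by (simp add: prod.distrib prod_power_distrib power_mult)
  also have "\<dots> \<le> real (fact H) ^ 3 * X ^ (3 * card ?PF)"
    using X by (intro mult_right_mono power_mono of_nat_mono prod_prime_power_multiplicity_le)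
       (auto intro!: prod_nonneg)
  finally show ?thesis .
qed

text \<open>Pigeonhole: one bad element from each of the \<open>B\<close> blocks would give
  \<open>B\<close> distinct ones, as \<open>m div H\<close> recovers the block.\<close>

lemma ex_good_block:
  fixes bad :: "nat \<Rightarrow> bool"
  assumes "card {m. m < B * H \<and> bad m} < B"
  obtains j where "j < B" "\<And>m. m \<in> {j * H..<j * H + H} \<Longrightarrow> \<not> bad m"
proof (rule ccontr)
  assume "\<not> thesis"
  hence "\<forall>j<B. \<exists>m. m \<in> {j * H..<j * H + H} \<and> bad m"
    using that by blast
  then obtain g where g: "\<And>j. j < B \<Longrightarrow> g j \<in> {j * H..<j * H + H} \<and> bad (g j)"
    by metis
  have gdiv: "g j div H = j" if "j < B" for j
    using g[OF that] by (intro div_nat_eqI) (auto simp: mult.commute)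
  have "card {..<B} \<le> card {m. m < B * H \<and> bad m}"
  proof (rule card_inj_on_le[of g])
    show "inj_on g {..<B}"
      by (rule inj_on_inverseI[of _ "\<lambda>m. m div H"]) (auto simp: gdiv)
    show "g ` {..<B} \<subseteq> {m. m < B * H \<and> bad m}"
    proof safe
      fix j assume j: "j < B"
      have "g j < j * H + H" using g[OF j] by simp
      also have "\<dots> \<le> B * H"
        using j by (metis Suc_leI add.commute mult_Suc mult_le_mono1)
      finally show "g j < B * H" .
      show "bad (g j)" using g[OF j] by simp
    qed
  qed auto
  thus False using assms by simp
qed

section \<open>Counting prime cubic residues\<close>

text \<open>On a block where all values are at least \<open>Y\<close>, their product is bounded
  below by \<open>Y ^ H\<close> and above by \<open>prod_le_of_few_roots\<close>. The
  \<open>+ 2\<close> allows for the primes 3 and \<open>p\<close>, to which reciprocity does not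
  apply.\<close>

lemma block_inequality:
  fixes p H Y :: nat and Z :: real
  assumes p: "prime p" "[p = 1] (mod 3)" and H: "H \<ge> 1" and Y: "Y \<ge> 1"
  defines "X \<equiv> 18522 * sqrt p * (real Y * real H) ^ 3"
  assumes XZ: "X < Z"
  defines "S \<equiv> {q. prime q \<and> real q < Z \<and> cubic_residue (int p) (int q)}"
  shows "real Y ^ H \<le> (real H ^ H) ^ 3 * X ^ (3 * (card S + 2))"
proof -
  obtain \<chi> where \<chi>: "cubic_character p \<chi>" and residue: "\<And>a. \<chi> a = 1 \<Longrightarrow> cubic_residue (int p) a"
    using cubic_character_exists[OF p] by blast
  interpret cubic_character p \<chi> by (rule \<chi>)
  define a b where "a = ere jacobi" and "b = eim jacobi"
  have jac: "jacobi = Eis a b" by (simp add: a_def b_def)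
  interpret cubic_form p a b
  proof
    show "p \<noteq> 3" using cong_to_1_nat[OF p(2)] by auto
    show "a\<^sup>2 - a * b + b\<^sup>2 = int p"
      using enorm_jacobi by (simp add: enorm_def a_def b_def)
  qed (rule p(1))
  obtain c where c: "c \<in> {0, 2}" "\<And>m. \<not> 9 dvd F (3 * m + c)"
    by (rule ex_progression) blast
  define f where "f = (\<lambda>m. nat \<bar>F (3 * int m + c)\<bar>)"
  have f_dvd: "d dvd f m \<longleftrightarrow> int d dvd F (3 * int m + c)" for d m
    unfolding f_def int_dvd_int_iff[symmetric] by simp
  \<comment> \<open>One block more than the bound \<open>6 * Y\<close> on the number of small
    values.\<close>
  define B where "B = 6 * Y + 1"
  have "card {m. m < B * H \<and> \<bar>F (3 * int m + c)\<bar> < int Y} < B"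
    using card_small_values[of "B * H" c Y] by (simp add: B_def)
  then obtain j where j: "j < B" "\<And>m. m \<in> {j * H..<j * H + H} \<Longrightarrow> \<not> \<bar>F (3 * int m + c)\<bar> < int Y"
    by (rule ex_good_block) blast
  define t where "t = j * H"
  have fY: "f m \<ge> Y" if "m \<in> {t..<t + H}" for m
    using j(2)[of m] that by (simp add: t_def f_def)
  have fX: "real (f m) \<le> X" if "m \<in> {t..<t + H}" for m
  proof -
    have "m < j * H + H" using that by (simp add: t_def)
    also have "\<dots> \<le> B * H"
      using j by (metis Suc_leI add.commute mult_Suc mult_le_mono1)
    also have "\<dots> \<le> 7 * Y * H"
      using Y by (intro mult_right_mono) (auto simp: B_def)
    finally have "m + 1 \<le> 7 * Y * H" by simp
    hence "int (m + 1) \<le> int (7 * Y * H)" by (rule of_nat_mono)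
    \<comment> \<open>Since \<open>c\<close> is at most 2, the left side is at most
      \<open>3 * (m + 1)\<close>. The factor 21 explains the constant
      \<open>18522 = 2 * 21 ^ 3\<close> in \<open>X\<close>.\<close>
    hence "3 * int m + c + 1 \<le> 21 * (int Y * int H)"
      using c(1) by (auto simp: mult.assoc)
    hence "real_of_int (3 * int m + c + 1) \<le> real_of_int (21 * (int Y * int H))"
      by (rule of_int_le_iff[THEN iffD2])
    hence n: "real_of_int (3 * int m + c) + 1 \<le> 21 * (real Y * real H)" by simp
    have c0: "3 * int m + c \<ge> 0" using c(1) by auto
    have "real (f m) = real_of_int \<bar>F (3 * int m + c)\<bar>"
      by (simp add: f_def)
    also have "\<dots> \<le> 2 * sqrt p * (real_of_int (3 * int m + c) + 1) ^ 3"
      by (rule abs_F_le[OF c0])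
    also have "\<dots> \<le> 2 * sqrt p * (21 * (real Y * real H)) ^ 3"
      using n c0 by (intro mult_left_mono power_mono) auto
    also have "\<dots> = X" by (simp add: X_def power_mult_distrib)
    finally show ?thesis .
  qed
  have X1: "X \<ge> 1"
    using fX[of t] fY[of t] H Y by simp
  define N where "N = (\<Prod>m\<in>{t..<t + H}. f m)"
  have le: "real N \<le> real (fact H) ^ 3 * X ^ (3 * card (prime_factors N))"
    unfolding N_def
  proof (rule prod_le_of_few_roots)
    show "f m > 0 \<and> real (f m) \<le> X" if "m \<in> {t..<t + H}" for m
      using fX[OF that] fY[OF that] Y by simp
    show "card {m \<in> {u..<u + q ^ e}. q ^ e dvd f m} \<le> 3" if "prime q" "e > 0" for q e u
    proof -
      have "q ^ e dvd f m \<longleftrightarrow> int (q ^ e) dvd F (3 * int m + c)" for m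
        by (rule f_dvd)
      thus ?thesis using few_roots[OF c(2) that, of u] by simp
    qed
  qed (rule X1)
  have finS: "finite S"
  proof (rule finite_subset)
    show "S \<subseteq> {..nat \<lceil>Z\<rceil>}"
    proof
      fix q assume "q \<in> S"
      hence "real q < Z" by (simp add: S_def)
      hence "q \<le> nat \<lceil>Z\<rceil>" by linarith
      thus "q \<in> {..nat \<lceil>Z\<rceil>}" by simp
    qed
  qed auto
  have "prime_factors N \<subseteq> S \<union> {3, p}"
  proof
    fix q assume "q \<in> prime_factors N"
    hence q: "prime q" "q dvd N" by auto
    then obtain m where m: "m \<in> {t..<t + H}" "q dvd f m"
      unfolding N_def by (auto simp: prime_dvd_prod_iff)
    have F: "int q dvd F (3 * int m + c)"
      using m(2) f_dvd by blast
    have "f m > 0" using fY[OF m(1)] Y by simp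
    hence "q \<le> f m" using m(2) by (rule dvd_imp_le[rotated])
    hence "real q < Z" using fX[OF m(1)] XZ by linarith
    moreover have "cubic_residue (int p) (int q)" if "q \<noteq> 3" "q \<noteq> p"
    proof (rule residue, rule cubic_reciprocity)
      show "int q dvd eim (jacobi * Eis (3 * int m + c) 1 ^ 3)"
        using F by (simp only: jac eim_cube)
      show "\<not> int q dvd enorm (Eis (3 * int m + c) 1)"
        using not_dvd_norm[OF q(1) that F] by (simp add: enorm_def)
    qed (use q that in auto)
    ultimately show "q \<in> S \<union> {3, p}"
      using q by (auto simp: S_def)
  qed
  hence "card (prime_factors N) \<le> card (S \<union> {3, p})"
    using finS by (intro card_mono) auto
  also have "\<dots> \<le> card S + card {3, p}" by (rule card_Un_le)
  also have "\<dots> \<le> card S + 2" by (simp add: card_insert_if)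
  finally have K: "card (prime_factors N) \<le> card S + 2" .
  have "Y ^ H = (\<Prod>m\<in>{t..<t + H}. Y)" by simp
  also have "\<dots> \<le> N"
    unfolding N_def by (intro prod_mono conjI fY) auto
  finally have "real Y ^ H \<le> real N"
    by (metis of_nat_le_iff of_nat_power)
  also note le
  also have "real (fact H) ^ 3 * X ^ (3 * card (prime_factors N)) \<le> (real H ^ H) ^ 3 * X ^ (3 * (card S + 2))"
  proof (intro mult_mono power_mono)
    show "real (fact H) \<le> real H ^ H"
      using fact_le_power[of H, where 'a = real] by simp
    show "X ^ (3 * card (prime_factors N)) \<le> X ^ (3 * (card S + 2))"
      using X1 K by (intro power_increasing) auto
  qed (use X1 in auto)
  finally show ?thesis .
qed

theorem theorem1:
  fixes \<epsilon> :: real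
  assumes "\<epsilon> > 0"
  shows "\<exists>p0::real. \<forall>p::nat. prime p \<and> [p = 1] (mod 3) \<and> real p > p0 \<longrightarrow>
           real (card {q::nat. prime q \<and> real q < real p powr (1/2 + \<epsilon>) \<and>
                               cubic_residue (int p) (int q)})
             > real p powr (\<epsilon> / 30)"
proof -
  \<comment> \<open>With \<open>s = p powr (\<epsilon> / 60)\<close>, \<open>C * ln s\<close> is the
    logarithm of \<open>p powr (1/2 + \<epsilon>)\<close>.\<close>
  define C where "C = (1/2 + \<epsilon>) * (60 / \<epsilon>)"
  \<comment> \<open>The first condition absorbs the constant 18522, the second keeps a factor
    positive, and the last contradicts the logarithm of \<open>block_inequality\<close> when
    \<open>card S\<close> is at most \<open>s\<^sup>2\<close>: a multiple of
    \<open>s ^ 3 * ln s\<close> outgrows one of \<open>s\<^sup>2 * ln s\<close>.\<close>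
  have "eventually (\<lambda>s::real. s ^ 15 > 18522 \<and> 3 * ln s > ln 2 \<and> s \<ge> 2 \<and>
          s ^ 3 / 2 * (3 * ln s - ln 2) > 3 * (s\<^sup>2 + 2) * (C * ln s)) at_top"
    by (intro eventually_conj; real_asymp)
  then obtain s0 where s0: "\<And>s::real. s \<ge> s0 \<Longrightarrow> s ^ 15 > 18522 \<and> 3 * ln s > ln 2 \<and> s \<ge> 2 \<and>
          s ^ 3 / 2 * (3 * ln s - ln 2) > 3 * (s\<^sup>2 + 2) * (C * ln s)"
    by (auto simp: eventually_at_top_linorder)
  define p0 where "p0 = max 1 s0 powr (60 / \<epsilon>)"
  show ?thesis
  proof (intro exI[of _ p0] allI impI, elim conjE)
    fix p :: nat
    assume p: "prime p" "[p = 1] (mod 3)" "real p > p0"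
    define s where "s = real p powr (\<epsilon> / 60)"
    define S where "S = {q::nat. prime q \<and> real q < real p powr (1/2 + \<epsilon>) \<and> cubic_residue (int p) (int q)}"
    have p_pos: "real p > 0" using prime_gt_0_nat[OF p(1)] by simp
    have "max 1 s0 = p0 powr (\<epsilon> / 60)"
      using \<open>\<epsilon> > 0\<close> by (simp add: p0_def powr_powr)
    also have "\<dots> \<le> s"
      unfolding s_def using p(3) \<open>\<epsilon> > 0\<close> by (intro powr_mono2) (auto simp: p0_def)
    finally have "s \<ge> s0" by simp
    note s = s0[OF this]
    have s2: "s \<ge> 2" and s_pos: "s > 0" using s by auto
    have lnp: "ln (real p) = 60 / \<epsilon> * ln s"
      using \<open>\<epsilon> > 0\<close> p_pos by (simp add: s_def ln_powr)
    have s_pow: "s ^ n = real p powr (real n * \<epsilon> / 60)" for n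
      using p_pos by (simp add: s_def powr_powr mult.commute flip: powr_realpow)
    \<comment> \<open>The exponent 12 exceeds \<open>3 * 3\<close>, so \<open>Y ^ H\<close>
      outweighs \<open>(H ^ H) ^ 3\<close>. Moreover \<open>(Y * H) ^ 3\<close> is at most
      \<open>s ^ 45\<close>, which leaves \<open>s ^ 15\<close> for the constant within
      \<open>s ^ 60 = p powr \<epsilon>\<close>.\<close>
    define H Y where "H = nat \<lfloor>s ^ 3\<rfloor>" and "Y = nat \<lfloor>s ^ 12\<rfloor>"
    have floor_bounds: "real (nat \<lfloor>x\<rfloor>) \<le> x" "real (nat \<lfloor>x\<rfloor>) \<ge> x / 2" "nat \<lfloor>x\<rfloor> \<ge> 1" if "x \<ge> 2" for x :: real
      using that by linarith+
    have pow2: "s ^ n \<ge> 2" if "n > 0" for n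
      using s2 that by (metis less_imp_le one_less_numeral_iff order_trans power_increasing power_one_right
          semiring_norm(76) Suc_leI One_nat_def order.trans)
    have H: "real H \<le> s ^ 3" "real H \<ge> s ^ 3 / 2" "H \<ge> 1"
      unfolding H_def by (intro floor_bounds pow2; simp)+
    have Y: "real Y \<le> s ^ 12" "real Y \<ge> s ^ 12 / 2" "Y \<ge> 1"
      unfolding Y_def by (intro floor_bounds pow2; simp)+
    define X where "X = 18522 * sqrt p * (real Y * real H) ^ 3"
    have "X \<le> 18522 * sqrt p * (s ^ 12 * s ^ 3) ^ 3"
      unfolding X_def using H Y s_pos by (intro mult_left_mono power_mono mult_mono) auto
    also have "\<dots> = sqrt p * s ^ 45 * 18522"
      by (simp flip: power_add power_mult)
    also have "\<dots> < sqrt p * s ^ 45 * s ^ 15"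
      using s p_pos s_pos by (intro mult_strict_left_mono) auto
    also have "\<dots> = sqrt p * s ^ 60"
      by (simp flip: power_add mult.assoc add: mult.assoc)
    also have "\<dots> = real p powr (1/2 + \<epsilon>)"
      using p_pos by (simp add: s_pow powr_add powr_half_sqrt)
    finally have XZ: "X < real p powr (1/2 + \<epsilon>)" .
    have "sqrt p \<ge> 1"
      using prime_gt_0_nat[OF p(1)] by simp
    moreover have "real Y * real H \<ge> 1"
      using H(3) Y(3) by (intro mult_ge1_I) auto
    ultimately have X1: "X \<ge> 1"
      unfolding X_def
      by (metis (no_types) mult_ge1_I one_le_numeral one_le_power)
    have "\<not> real (card S) \<le> real p powr (\<epsilon> / 30)"
    proof
      assume "real (card S) \<le> real p powr (\<epsilon> / 30)"
      also have "\<dots> = s\<^sup>2" by (simp add: s_pow)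
      finally have cardS: "real (card S) \<le> s\<^sup>2" .
      have "real Y ^ H \<le> (real H ^ H) ^ 3 * X ^ (3 * (card S + 2))"
        unfolding X_def S_def using p H Y XZ[unfolded X_def] by (intro block_inequality) auto
      hence "ln (real Y ^ H) \<le> ln ((real H ^ H) ^ 3 * X ^ (3 * (card S + 2)))"
        using Y by (subst ln_le_cancel_iff) (use H X1 in auto)
      hence main: "real H * ln (real Y) \<le> 3 * real H * ln (real H) + 3 * (real (card S) + 2) * ln X"
        using H Y X1 by (simp add: ln_mult ln_realpow algebra_simps)
      have "ln X \<le> ln (real p powr (1/2 + \<epsilon>))"
        using XZ X1 p_pos by (subst ln_le_cancel_iff) auto
      also have "\<dots> = C * ln s"
        using p_pos by (simp add: ln_powr lnp C_def)
      finally have lnX: "ln X \<le> C * ln s" .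
      have "ln (real H) \<le> ln (s ^ 3)"
        using H s_pos by (subst ln_le_cancel_iff) auto
      hence lnH: "ln (real H) \<le> 3 * ln s"
        using s_pos by (simp add: ln_realpow)
      have "ln (s ^ 12 / 2) \<le> ln (real Y)"
        using Y s_pos by (subst ln_le_cancel_iff) auto
      hence lnY: "ln (real Y) \<ge> 12 * ln s - ln 2"
        using s_pos by (simp add: ln_div ln_realpow)
      have "s ^ 3 / 2 * (3 * ln s - ln 2) \<le> real H * (3 * ln s - ln 2)"
        using H s by (intro mult_right_mono) auto
      also have "\<dots> \<le> real H * (ln (real Y) - 3 * ln (real H))"
        using lnY lnH by (intro mult_left_mono) auto
      also have "\<dots> \<le> 3 * (real (card S) + 2) * ln X"
        using main by (simp add: algebra_simps)
      also have "\<dots> \<le> 3 * (s\<^sup>2 + 2) * (C * ln s)"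
        using cardS lnX X1 by (intro mult_mono) auto
      finally show False using s by simp
    qed
    thus "real (card {q::nat. prime q \<and> real q < real p powr (1/2 + \<epsilon>) \<and> cubic_residue (int p) (int q)})
             > real p powr (\<epsilon> / 30)"
      by (simp add: S_def)
  qed
qed

end
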